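(* Let $p>1$, $\frac1p+\frac1q=1$, $2<\alpha\le 3$, $\eta\in(0,1)$, and let $\rho\in(0,1)$ be fixed. Let $f\in C([0,1]\times[0,\infty),[0,\infty))$ with $f(t,0)\not\equiv 0$ on $[0,1]$, and let $a\in C([0,1],[0,\infty))$ with $a(t)\not\equiv0$ on any subinterval of $[0,1]$. Set $$\gamma=(1-\eta^{\alpha-2})(1-\rho^{\alpha-1}),\qquad \Phi(s)=\frac{(\alpha-s)(1-s)^{\alpha-2}}{\Gamma(\alpha)},$$ $$\Lambda_1=\Big(\varphi_q\Big(\int_0^1a(\tau)\,d\tau\Big)\int_0^1\Phi(s)\,ds\Big)^{-1},\qquad \Lambda_2=\Big(\gamma\int_0^\rho\Phi(s)\,\varphi_q\Big(\int_0^s a(\tau)\,d\tau\Big)ds\Big)^{-1}.$$ Suppose there exist constants $\rho_1>0$, $\rho_2>0$, $M_1\in(0,\Lambda_1]$ and $M_2\in[\Lambda_2,\infty)$, where $\rho_1<\rho_2$ and $M_2\rho_1<M_1\rho_2$, such that $f$ satisfies (i) $f(t,u)\le\varphi_p(M_1\rho_2)$ for all $u\in[0,\rho_2]$ and $t\in[0,1]$, and (ii) $f(t,u)\ge\varphi_p(M_2\rho_1)$ for all $u\in[\gamma\rho_1,\rho_1]$ and $t\in[0,\rho]$. Then the boundary value problem $$\big(\varphi_p(D^\alpha u(t))\big)'+a(t)f(t,u(t))=0,\quad t\in(0,1),$$ $$D^\alpha u(0)=u'(0)=u''(0)=0,\qquad u(1)+u'(1)=u'(\eta),$$ has at least one positive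 solution $u\in\mathcal P$ satisfying $\rho_1<\|u\|<\rho_2$, where $$\mathcal P=\Big\{u\in C([0,1],\mathbb R):\ u(t)\ge0 \text{ for } t\in[0,1],\ \min_{t\in[0,\rho]}u(t)\ge\gamma\|u\|\Big\}.$$
   Context: Norm: $\|u\|=\sup_{t\in[0,1]}|u(t)|$ on $C([0,1],\mathbb R)$. $\varphi_p(s)=|s|^{p-2}s$ is the $p$-Laplacian operator, and $\varphi_q=\varphi_p^{-1}$ with $\frac1p+\frac1q=1$. $\Gamma$ is the gamma function. $D^\alpha$ is the standard Caputo derivative of order $\alpha$: for an at least $n$-times continuously differentiable function $g$, $D^\alpha g(t)=\frac{1}{\Gamma(n-\alpha)}\int_0^t\frac{g^{(n)}(s)}{(t-s)^{\alpha+1-n}}\,ds$, $n-1<\alpha<n$, $n=[\alpha]+1$, where $[\alpha]$ is the integer part of $\alpha$. A positive solution of the boundary value problem is a solution $u$ with $u\in C([0,1])$ and $u(t)>0$ for all $t\in(0,1)$.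
   Formalization: For α<3 a solution is C^2 with u'' absolutely continuous, the Caputo integral absolutely convergent and D^α u continuous, since C^3 solutions can fail to exist (a=1, f constant, α=2.2, p=3); for α=3, where the formula is undefined, D^α u means u'''. *)

theory Defs
  imports "HOL-Analysis.Analysis"
begin

definition sup_norm :: "(real \<Rightarrow> real) \<Rightarrow> real" where
  "sup_norm u = (SUP t\<in>{0..1}. \<bar>u t\<bar>)"

definition phi :: "real \<Rightarrow> real \<Rightarrow> real" where
  "phi p s = \<bar>s\<bar> powr (p - 2) * s"


text \<open>Derivatives are taken within [0,1], hence one-sided at the end points; the values of a
  function outside [0,1] play no role.\<close>

definition nderiv :: "nat \<Rightarrow> (real \<Rightarrow> real) \<Rightarrow> real \<Rightarrow> real" where
  "nderiv n g = ((\<lambda>h t. vector_derivative h (at t within {0..1})) ^^ n) g"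

definition cont_diff :: "nat \<Rightarrow> (real \<Rightarrow> real) \<Rightarrow> bool" where
  "cont_diff n g \<longleftrightarrow>
     (\<forall>k<n. \<forall>t\<in>{0..1}. nderiv k g differentiable (at t within {0..1})) \<and>
     continuous_on {0..1} (nderiv n g)"

text \<open>The usual epsilon-delta definition: D is a finite family of nonoverlapping compact
  intervals contained in [0,1].\<close>

definition abs_continuous :: "(real \<Rightarrow> real) \<Rightarrow> bool" where
  "abs_continuous g \<longleftrightarrow>
     (\<forall>\<epsilon>>0. \<exists>\<delta>>0. \<forall>D. D division_of \<Union>D \<and> \<Union>D \<subseteq> {0..1} \<and> (\<Sum>K\<in>D. Sup K - Inf K) < \<delta> \<longrightarrow>
        (\<Sum>K\<in>D. \<bar>g (Sup K) - g (Inf K)\<bar>) < \<epsilon>)"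


text \<open>For non-integer \<open>\<alpha>\<close> we have \<open>n = \<lceil>\<alpha>\<rceil> = \<lfloor>\<alpha>\<rfloor> + 1\<close>. For integer \<open>\<alpha>\<close> the integral formula is not
  available and the Caputo derivative is the classical derivative of order \<open>\<alpha>\<close>.\<close>

definition caputo_kernel :: "real \<Rightarrow> (real \<Rightarrow> real) \<Rightarrow> real \<Rightarrow> real \<Rightarrow> real" where
  "caputo_kernel \<alpha> g t s =
     (let n = nat \<lceil>\<alpha>\<rceil> in nderiv n g s / (t - s) powr (\<alpha> + 1 - real n))"

definition caputo :: "real \<Rightarrow> (real \<Rightarrow> real) \<Rightarrow> real \<Rightarrow> real" where
  "caputo \<alpha> g t =
     (let n = nat \<lceil>\<alpha>\<rceil> in
      if \<alpha> = real n then nderiv n g t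
      else 1 / Gamma (real n - \<alpha>) * integral {0..t} (caputo_kernel \<alpha> g t))"

text \<open>The class on which the Caputo derivative is used: for non-integer \<open>\<alpha>\<close>, functions of class
  \<open>C\<^sup>n\<^sup>-\<^sup>1\<close> on [0,1] whose derivative of order \<open>n - 1\<close> is absolutely continuous, such that the defining
  integral converges absolutely at every point. Every function of class \<open>C\<^sup>n\<close> qualifies, but
  solutions of equations with the p-Laplacian are in general not of class \<open>C\<^sup>n\<close> when \<open>p > 2\<close>:
  the derivative of order \<open>n\<close> may be unbounded at 0 and exist only almost everywhere (its
  values on the exceptional null set do not affect the integral).\<close>

definition caputo_differentiable :: "real \<Rightarrow> (real \<Rightarrow> real) \<Rightarrow> bool" where
  "caputo_differentiable \<alpha> g \<longleftrightarrow>
     (let n = nat \<lceil>\<alpha>\<rceil> in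
      if \<alpha> = real n then cont_diff n g
      else cont_diff (n - 1) g \<and> abs_continuous (nderiv (n - 1) g) \<and>
           (\<forall>t\<in>{0..1}. caputo_kernel \<alpha> g t absolutely_integrable_on {0..t}))"


text \<open>Continuity of \<open>caputo \<alpha> u\<close> on [0,1] is what gives the condition \<open>caputo \<alpha> u 0 = 0\<close> its content:
  for non-integer \<open>\<alpha>\<close> the integral over \<open>{0..0}\<close> is always 0.\<close>

definition bvp_solution ::
  "real \<Rightarrow> real \<Rightarrow> real \<Rightarrow> (real \<Rightarrow> real) \<Rightarrow> (real \<Rightarrow> real \<Rightarrow> real) \<Rightarrow> (real \<Rightarrow> real) \<Rightarrow> bool" where
  "bvp_solution p \<alpha> \<eta> a f u \<longleftrightarrow>
     continuous_on {0..1} u \<and>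
     caputo_differentiable \<alpha> u \<and>
     continuous_on {0..1} (caputo \<alpha> u) \<and>
     (\<forall>t\<in>{0<..<1}. \<exists>d. ((\<lambda>t. phi p (caputo \<alpha> u t)) has_real_derivative d) (at t) \<and>
                         d + a t * f t (u t) = 0) \<and>
     caputo \<alpha> u 0 = 0 \<and> nderiv 1 u 0 = 0 \<and> nderiv 2 u 0 = 0 \<and>
     u 1 + nderiv 1 u 1 = nderiv 1 u \<eta>"

definition positive_solution ::
  "real \<Rightarrow> real \<Rightarrow> real \<Rightarrow> (real \<Rightarrow> real) \<Rightarrow> (real \<Rightarrow> real \<Rightarrow> real) \<Rightarrow> (real \<Rightarrow> real) \<Rightarrow> bool" where
  "positive_solution p \<alpha> \<eta> a f u \<longleftrightarrow>
     bvp_solution p \<alpha> \<eta> a f u \<and> (\<forall>t\<in>{0<..<1}. u t > 0)"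


definition cone_const :: "real \<Rightarrow> real \<Rightarrow> real \<Rightarrow> real" where
  "cone_const \<alpha> \<eta> \<rho> = (1 - \<eta> powr (\<alpha> - 2)) * (1 - \<rho> powr (\<alpha> - 1))"

text \<open>The infimum over \<open>{0..\<rho>}\<close> is attained, as \<open>u\<close> is continuous and \<open>\<rho>\<close> lies in [0,1].\<close>

definition bvp_cone :: "real \<Rightarrow> real \<Rightarrow> real \<Rightarrow> (real \<Rightarrow> real) set" where
  "bvp_cone \<alpha> \<eta> \<rho> =
     {u. continuous_on {0..1} u \<and> (\<forall>t\<in>{0..1}. u t \<ge> 0) \<and>
         (INF t\<in>{0..\<rho>}. u t) \<ge> cone_const \<alpha> \<eta> \<rho> * sup_norm u}"

definition Phi :: "real \<Rightarrow> real \<Rightarrow> real" where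
  "Phi \<alpha> s = (\<alpha> - s) * (1 - s) powr (\<alpha> - 2) / Gamma \<alpha>"

definition Lambda1 :: "real \<Rightarrow> real \<Rightarrow> (real \<Rightarrow> real) \<Rightarrow> real" where
  "Lambda1 q \<alpha> a = inverse (phi q (integral {0..1} a) * integral {0..1} (Phi \<alpha>))"

definition Lambda2 :: "real \<Rightarrow> real \<Rightarrow> real \<Rightarrow> real \<Rightarrow> (real \<Rightarrow> real) \<Rightarrow> real" where
  "Lambda2 q \<alpha> \<eta> \<rho> a =
     inverse (cone_const \<alpha> \<eta> \<rho> * integral {0..\<rho>} (\<lambda>s. Phi \<alpha> s * phi q (integral {0..s} a)))"

end

theory Submission
  imports Defs "HOL-Complex_Analysis.Great_Picard"
begin

text \<open>Inverting both derivatives turns the problem into \<open>u = S (y u)\<close>, where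
  \<open>y u t = \<phi>\<^sub>q (\<integral>\<^sub>0\<^sup>t a(s) f(s, u(s)) ds)\<close> is nonnegative and increasing and
  \<open>S y = \<integral>\<^sub>0\<^sup>1 \<Phi> y - I\<^sup>\<alpha>\<^sup>-\<^sup>1 y(\<eta>) - I\<^sup>\<alpha> y\<close>. Such an \<open>S y\<close> is decreasing and lies in the cone, so its
  norm is \<open>S y 0\<close>; (i) gives \<open>S (y u) 0 < \<rho>\<^sub>2\<close> on the ball of radius \<open>\<rho>\<^sub>2\<close>, and (ii) gives
  \<open>S (y u) 0 > \<rho>\<^sub>1\<close> when \<open>u\<close> has values in \<open>[\<gamma> \<rho>\<^sub>1, \<rho>\<^sub>1]\<close> on \<open>[0, \<rho>]\<close>. Instead of a fixed point index we
  apply Schauder's theorem to \<open>u \<mapsto> S (y (u + max 0 (\<rho>\<^sub>1 - u(0))))\<close>: if its fixed point had norm at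
  most \<open>\<rho>\<^sub>1\<close>, the shifted function would have norm \<open>\<rho>\<^sub>1\<close> and lie in the cone, and (ii) would give
  a contradiction. So the shift vanishes at the fixed point.

  For the regularity, \<open>y\<close> is the integral of some \<open>k \<ge> 0\<close>. The semigroup law of fractional
  integration yields \<open>u'' = - I\<^sup>1 (I\<^sup>\<alpha>\<^sup>-\<^sup>2 k)\<close>, which is absolutely continuous with derivative
  \<open>- I\<^sup>\<alpha>\<^sup>-\<^sup>2 k\<close> almost everywhere, and \<open>I\<^sup>3\<^sup>-\<^sup>\<alpha> (I\<^sup>\<alpha>\<^sup>-\<^sup>2 k) = y\<close>.\<close>

section \<open>A fixed point theorem on \<open>C([0,1])\<close>\<close>

text \<open>The library states Brouwer's theorem for a Euclidean type, whose dimension is fixed; here the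
  dimension has to tend to infinity, so we return to Kuhn's combinatorial lemma.\<close>

lemma approx_fixpoint_cube:
  fixes F :: "(nat \<Rightarrow> real) \<Rightarrow> nat \<Rightarrow> real"
  assumes maps: "\<And>x i. (\<And>j. j < n \<Longrightarrow> x j \<in> {0..1}) \<Longrightarrow> i < n \<Longrightarrow> F x i \<in> {0..1}"
    and uc: "\<And>e. e > 0 \<Longrightarrow> \<exists>d>0. \<forall>x y. (\<forall>j<n. x j \<in> {0..1} \<and> y j \<in> {0..1} \<and> \<bar>x j - y j\<bar> < d)
               \<longrightarrow> (\<forall>j<n. \<bar>F x j - F y j\<bar> < e)"
    and "e > 0"
  obtains x where "\<And>j. j < n \<Longrightarrow> x j \<in> {0..1}" "\<And>j. j < n \<Longrightarrow> \<bar>F x j - x j\<bar> < e"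
proof -
  obtain d where "d > 0" and d: "\<And>x y j. (\<forall>j<n. x j \<in> {0..1} \<and> y j \<in> {0..1} \<and> \<bar>x j - y j\<bar> < d)
               \<Longrightarrow> j < n \<Longrightarrow> \<bar>F x j - F y j\<bar> < e / 4"
    using uc[of "e / 4"] \<open>e > 0\<close> by auto
  \<comment> \<open>The mesh \<open>1 / p\<close> is below the modulus \<open>d\<close> and below
    \<open>e / 4\<close>, so within one cell neither the coordinates nor the values of
    \<open>F\<close> vary by more than \<open>e / 4\<close>.\<close>
  obtain p :: nat where p: "p > 0" "1 / p < min d (e / 4)"
    using real_arch_inverse[of "min d (e / 4)"] \<open>d > 0\<close> \<open>e > 0\<close> by (auto simp: field_simps)
  define sc where "sc = (\<lambda>(z :: nat \<Rightarrow> nat) j. real (z j) / p)"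
  have sc01: "\<forall>j<n. sc z j \<in> {0..1}" if "\<forall>j<n. z j \<le> p" for z
    using that p by (auto simp: sc_def divide_simps)
  \<comment> \<open>Label 0 records that \<open>F\<close> does not decrease coordinate
    \<open>i\<close>, label 1 that it does not increase it. Kuhn's lemma prescribes the labels on
    the faces \<open>z i = 0\<close> and \<open>z i = p\<close>; since \<open>F\<close> maps into
    the cube, they are correct there too.\<close>
  define lab where "lab z i = (if z i = 0 \<or> (z i \<noteq> p \<and> sc z i \<le> F (sc z) i) then 0 else (1::nat))" for z i
  have lab0: "sc z i \<le> F (sc z) i" if "\<forall>j<n. z j \<le> p" "i < n" "lab z i = 0" for z i
    using that maps[of "sc z" i] sc01[of z] by (auto simp: lab_def sc_def split: if_splits)
  have lab1: "F (sc z) i \<le> sc z i" if "\<forall>j<n. z j \<le> p" "i < n" "lab z i = 1" for z i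
    using that maps[of "sc z" i] sc01[of z] p by (auto simp: lab_def sc_def split: if_splits)
  obtain q where q: "\<forall>i<n. q i < p"
    and rs: "\<forall>i<n. \<exists>r s. (\<forall>j<n. q j \<le> r j \<and> r j \<le> q j + 1) \<and>
               (\<forall>j<n. q j \<le> s j \<and> s j \<le> q j + 1) \<and> lab r i \<noteq> lab s i"
    by (rule kuhn_lemma[of p n lab]) (use p in \<open>auto simp: lab_def\<close>)
  have qle: "\<forall>j<n. q j \<le> p" using q by auto
  have near: "\<bar>F (sc r) i - F (sc q) i\<bar> < e / 4 \<and> sc q i \<le> sc r i \<and> sc r i \<le> sc q i + e / 4"
      and rle: "\<forall>j<n. r j \<le> p"
    if r: "\<forall>j<n. q j \<le> r j \<and> r j \<le> q j + 1" and i: "i < n" for r i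
  proof -
    show rle: "\<forall>j<n. r j \<le> p" using r q by fastforce
    have *: "sc q j \<le> sc r j \<and> sc r j \<le> sc q j + 1 / p" if "j < n" for j
    proof -
      have "real (q j) \<le> real (r j)" "real (r j) \<le> real (q j) + 1" using r that by fastforce+
      thus ?thesis using p by (auto simp: sc_def divide_simps)
    qed
    have "\<bar>sc r j - sc q j\<bar> < d" if "j < n" for j using *[OF that] p by auto
    hence "\<bar>F (sc r) i - F (sc q) i\<bar> < e / 4"
      using d[of "sc r" "sc q" i] sc01[OF rle] sc01[OF qle] i by auto
    thus "\<bar>F (sc r) i - F (sc q) i\<bar> < e / 4 \<and> sc q i \<le> sc r i \<and> sc r i \<le> sc q i + e / 4"
      using *[OF i] p by auto
  qed
  have "\<bar>F (sc q) i - sc q i\<bar> < e" if i: "i < n" for i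
  proof -
    \<comment> \<open>A vertex labelled 0 bounds \<open>F (sc q) i\<close> from below and a vertex
      labelled 1 bounds it from above, up to the variation of \<open>F\<close> and of the
      coordinates within the cell, at most \<open>e / 2\<close> in total.\<close>
    have fin: ?thesis if r: "\<forall>j<n. q j \<le> r j \<and> r j \<le> q j + 1" and s: "\<forall>j<n. q j \<le> s j \<and> s j \<le> q j + 1"
      and "lab r i = 0" "lab s i = 1" for r s
      using near[OF r i] near[OF s i] lab0[OF rle[OF r i] i that(3)] lab1[OF rle[OF s i] i that(4)] \<open>e > 0\<close>
      by linarith
    obtain r s where r: "\<forall>j<n. q j \<le> r j \<and> r j \<le> q j + 1" and s: "\<forall>j<n. q j \<le> s j \<and> s j \<le> q j + 1"
      and ne: "lab r i \<noteq> lab s i" using rs i by blast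
    show ?thesis
    proof (cases "lab r i = 0")
      case True
      thus ?thesis using fin[OF r s] ne by (auto simp: lab_def split: if_splits)
    next
      case False
      thus ?thesis using fin[OF s r] ne by (auto simp: lab_def split: if_splits)
    qed
  qed
  thus ?thesis using that[of "sc q"] sc01[OF qle] by blast
qed

section \<open>Interpolation on a uniform grid and Schauder's theorem\<close>

text \<open>Schauder's theorem on \<open>C([0,1])\<close> is reduced to finite dimension by sampling a function on a
  uniform grid. Only averaging properties of the interpolation are needed, so the hat functions
  are normalised by their sum instead of being shown to form a partition of unity.\<close>

definition hat :: "nat \<Rightarrow> nat \<Rightarrow> real \<Rightarrow> real" where
  "hat N i t = max 0 (1 - \<bar>N * t - i\<bar>)"

definition interp :: "nat \<Rightarrow> (nat \<Rightarrow> real) \<Rightarrow> real \<Rightarrow> real" where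
  "interp N x t = (\<Sum>i\<le>N. x i * hat N i t) / (\<Sum>i\<le>N. hat N i t)"

lemma sum_hat_pos:
  assumes "t \<in> {0..1}"
  shows "(\<Sum>i\<le>N. hat N i t) > 0"
proof (rule sum_pos2)
  let ?i = "nat \<lfloor>N * t\<rfloor>"
  have 0: "0 \<le> N * t" and 1: "N * t \<le> N" using assms by (auto simp: mult_left_le)
  show "?i \<in> {..N}" using 0 1 by (simp add: nat_le_iff floor_le_iff) 
  have "real ?i = of_int \<lfloor>N * t\<rfloor>" using 0 by simp
  thus "0 < hat N ?i t" unfolding hat_def by linarith
qed (auto simp: hat_def)

lemma continuous_on_interp: "continuous_on {0..1} (interp N x)"
  unfolding interp_def hat_def
  using sum_hat_pos[of _ N, unfolded hat_def]
  by (intro continuous_intros) (metis less_irrefl)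

text \<open>\<open>interp\<close> is a weighted mean of node values in which only nodes within
  \<open>1 / N\<close> of \<open>t\<close> can carry weight. The estimate serves with three centres
  \<open>c\<close>: \<open>R / 2\<close> for the range, 0 for the dependence on the node values, and
  \<open>T (P x) t\<close> for the approximation error.\<close>

lemma interp_near:
  assumes t: "t \<in> {0..1}" and "N > 0"
    and near: "\<And>i. i \<le> N \<Longrightarrow> \<bar>t - i / N\<bar> \<le> 1 / N \<Longrightarrow> \<bar>x i - c\<bar> \<le> b"
  shows "\<bar>interp N x t - c\<bar> \<le> b"
proof -
  have S: "(\<Sum>i\<le>N. hat N i t) > 0" using sum_hat_pos[OF t] .
  have "\<bar>x i - c\<bar> * hat N i t \<le> b * hat N i t" if "i \<le> N" for i
  proof (cases "hat N i t = 0")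
    case False
    hence "\<bar>N * t - i\<bar> \<le> 1" by (auto simp: hat_def)
    moreover have "\<bar>t - i / N\<bar> = \<bar>N * t - i\<bar> / N"
      using \<open>N > 0\<close> abs_divide[of "N * t - i" N] by (simp add: diff_divide_distrib)
    ultimately have "\<bar>t - i / N\<bar> \<le> 1 / N" using \<open>N > 0\<close> by (simp add: divide_right_mono)
    thus ?thesis using near[OF that] by (intro mult_right_mono) (auto simp: hat_def)
  qed auto
  hence "(\<Sum>i\<le>N. \<bar>x i - c\<bar> * hat N i t) \<le> (\<Sum>i\<le>N. b * hat N i t)"
    by (intro sum_mono) auto
  moreover have "\<bar>\<Sum>i\<le>N. (x i - c) * hat N i t\<bar> \<le> (\<Sum>i\<le>N. \<bar>x i - c\<bar> * hat N i t)"
    by (rule order_trans[OF sum_abs]) (auto simp: abs_mult hat_def intro!: sum_mono)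
  moreover have "interp N x t - c = (\<Sum>i\<le>N. (x i - c) * hat N i t) / (\<Sum>i\<le>N. hat N i t)"
    using S by (simp add: interp_def field_simps sum_subtractf sum_distrib_left)
  ultimately show ?thesis using S
    by (simp add: pos_divide_le_eq sum_distrib_left)
qed

lemma interp_diff: "interp N x t - interp N y t = interp N (\<lambda>i. x i - y i) t"
  by (simp add: interp_def left_diff_distrib sum_subtractf diff_divide_distrib)

text \<open>The result on the cube is applied to node values scaled by \<open>R\<close>:
  interpolate, apply \<open>T\<close>, sample again. The common Lipschitz constant extends closeness
  at the nodes to closeness on [0,1].\<close>

lemma approx_fixed_point:
  fixes T :: "(real \<Rightarrow> real) \<Rightarrow> real \<Rightarrow> real"
  defines "B \<equiv> \<lambda>R. {u. continuous_on {0..1} u \<and> u ` {0..1} \<subseteq> {0..R}}"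
  assumes "R > 0"
    and maps: "\<And>u t. u \<in> B R \<Longrightarrow> t \<in> {0..1} \<Longrightarrow> T u t \<in> {0..R}"
    and lip: "\<And>u s t. u \<in> B R \<Longrightarrow> s \<in> {0..1} \<Longrightarrow> t \<in> {0..1} \<Longrightarrow> \<bar>T u s - T u t\<bar> \<le> L * \<bar>s - t\<bar>"
    and uc: "\<And>e. e > 0 \<Longrightarrow> \<exists>d>0. \<forall>u\<in>B R. \<forall>v\<in>B R. (\<forall>t\<in>{0..1}. \<bar>u t - v t\<bar> \<le> d)
               \<longrightarrow> (\<forall>t\<in>{0..1}. \<bar>T u t - T v t\<bar> < e)"
    and "e > 0"
  obtains v where "v \<in> B R" "\<And>t. t \<in> {0..1} \<Longrightarrow> \<bar>T v t - v t\<bar> < e"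
proof -
  have "L \<ge> 0"
  proof -
    have "(\<lambda>_. 0) \<in> B R" using \<open>R > 0\<close> by (auto simp: B_def)
    from lip[OF this, of 0 1] show ?thesis by auto
  qed
  \<comment> \<open>\<open>L / N\<close> bounds the variation of \<open>T u\<close> between
    neighbouring nodes; \<open>L + 1\<close> avoids a division by 0 when
    \<open>L = 0\<close>.\<close>
  obtain N :: nat where N: "N > 0" "(L + 1) / N < e / 2"
    using real_arch_inverse[of "e / 2 / (L + 1)"] \<open>e > 0\<close> \<open>L \<ge> 0\<close>
    by (auto simp: field_simps)
  define P where "P x = interp N (\<lambda>i. R * x i)" for x
  define F where "F x i = T (P x) (i / N) / R" for x i
  have PB: "P x \<in> B R" if "\<And>j. j < Suc N \<Longrightarrow> x j \<in> {0..1}" for x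
  proof -
    have "P x t \<in> {0..R}" if t: "t \<in> {0..1}" for t
    proof -
      \<comment> \<open>[0,R] is treated as the ball of radius \<open>R / 2\<close> about
        \<open>R / 2\<close>, the form that \<open>interp_near\<close> handles.\<close>
      have "\<bar>P x t - R / 2\<bar> \<le> R / 2"
        unfolding P_def
      proof (rule interp_near[OF t N(1)])
        fix i assume "i \<le> N"
        hence "0 \<le> x i" "x i \<le> 1" using \<open>\<And>j. j < Suc N \<Longrightarrow> x j \<in> {0..1}\<close>[of i] by auto
        hence "0 \<le> R * x i" "R * x i \<le> R" using \<open>R > 0\<close> by auto
        thus "\<bar>R * x i - R / 2\<bar> \<le> R / 2" by (simp add: abs_if)
      qed
      thus ?thesis by (auto simp: abs_if field_simps split: if_splits)
    qed
    thus ?thesis by (auto simp: B_def P_def continuous_on_interp)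
  qed
  have grid: "i / N \<in> {0..1}" if "i < Suc N" for i
    using that N by (auto simp: divide_simps)
  have "e / (2 * R) > 0" using \<open>e > 0\<close> \<open>R > 0\<close> by simp
  obtain x where x: "\<And>j. j < Suc N \<Longrightarrow> x j \<in> {0..1}"
    and fx: "\<And>j. j < Suc N \<Longrightarrow> \<bar>F x j - x j\<bar> < e / (2 * R)"
  proof (rule approx_fixpoint_cube[of "Suc N" F "e / (2 * R)"])
    show "F x i \<in> {0..1}" if "\<And>j. j < Suc N \<Longrightarrow> x j \<in> {0..1}" "i < Suc N" for x i
      using maps[OF PB[OF that(1)] grid[OF that(2)]] \<open>R > 0\<close> by (auto simp: F_def divide_simps)
    fix e' :: real assume "e' > 0"
    hence "e' * R > 0" using \<open>R > 0\<close> by simp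
    from uc[OF this] obtain d where "d > 0" and d: "\<And>u v t. u \<in> B R \<Longrightarrow> v \<in> B R \<Longrightarrow>
        (\<And>t. t \<in> {0..1} \<Longrightarrow> \<bar>u t - v t\<bar> \<le> d) \<Longrightarrow> t \<in> {0..1} \<Longrightarrow> \<bar>T u t - T v t\<bar> < e' * R"
      by metis
    show "\<exists>d>0. \<forall>x y. (\<forall>j<Suc N. x j \<in> {0..1} \<and> y j \<in> {0..1} \<and> \<bar>x j - y j\<bar> < d)
               \<longrightarrow> (\<forall>j<Suc N. \<bar>F x j - F y j\<bar> < e')"
    proof (intro exI[of _ "d / R"] conjI allI impI)
      show "d / R > 0" using \<open>d > 0\<close> \<open>R > 0\<close> by simp
      fix x y :: "nat \<Rightarrow> real" and j
      assume xy: "\<forall>j<Suc N. x j \<in> {0..1} \<and> y j \<in> {0..1} \<and> \<bar>x j - y j\<bar> < d / R" and j: "j < Suc N"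
      have PP: "\<bar>P x t - P y t\<bar> \<le> d" if t: "t \<in> {0..1}" for t
      proof -
        have "\<bar>interp N (\<lambda>i. R * x i - R * y i) t - 0\<bar> \<le> d"
        proof (rule interp_near[OF t N(1)])
          fix i assume "i \<le> N"
          hence "\<bar>x i - y i\<bar> < d / R" using xy by auto
          hence "R * \<bar>x i - y i\<bar> \<le> d" using \<open>R > 0\<close> by (simp add: pos_less_divide_eq mult.commute)
          moreover have "\<bar>R * x i - R * y i\<bar> = R * \<bar>x i - y i\<bar>"
            using abs_mult[of R "x i - y i"] \<open>R > 0\<close> by (simp add: right_diff_distrib)
          ultimately show "\<bar>R * x i - R * y i - 0\<bar> \<le> d" by simp
        qed
        thus ?thesis by (simp add: P_def interp_diff)
      qed
      have "\<bar>T (P x) (j / N) - T (P y) (j / N)\<bar> < e' * R"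
        using d[OF PB PB PP grid[OF j]] xy by blast
      thus "\<bar>F x j - F y j\<bar> < e'"
        using \<open>R > 0\<close> by (simp add: F_def diff_divide_distrib [symmetric] divide_simps)
    qed
  qed (use \<open>e / (2 * R) > 0\<close> in auto)
  \<comment> \<open>For a node near \<open>t\<close>, \<open>R * x i\<close> is within
    \<open>e / 2\<close> of \<open>T (P x) (i / N)\<close>, which is within \<open>L / N\<close> of
    \<open>T (P x) t\<close>; averaging preserves the sum of the two errors.\<close>
  have "\<bar>P x t - T (P x) t\<bar> \<le> e / 2 + L / N" if t: "t \<in> {0..1}" for t
    unfolding P_def[of x]
  proof (rule interp_near[OF t N(1)])
    fix i assume i: "i \<le> N" "\<bar>t - i / N\<bar> \<le> 1 / N"
    hence "\<bar>T (P x) (i / N) / R - x i\<bar> < e / (2 * R)" using fx[of i] by (auto simp: F_def)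
    hence "\<bar>T (P x) (i / N) - R * x i\<bar> < e / 2" using \<open>R > 0\<close>
      by (simp add: abs_if divide_simps split: if_splits) (auto simp: algebra_simps)
    moreover have "\<bar>T (P x) (i / N) - T (P x) t\<bar> \<le> L * \<bar>i / N - t\<bar>"
      by (rule lip[OF PB[OF x] grid t]) (use i in auto)
    moreover have "L * \<bar>i / N - t\<bar> \<le> L * (1 / N)"
      using i \<open>L \<ge> 0\<close> by (intro mult_left_mono) auto
    ultimately have "\<bar>R * x i - T (P x) t\<bar> \<le> e / 2 + L / N" by (simp add: abs_if split: if_splits)
    thus "\<bar>R * x i - T (interp N (\<lambda>i. R * x i)) t\<bar> \<le> e / 2 + L / N" by (simp add: P_def)
  qed
  moreover have "L / N < e / 2" using N by (simp add: divide_simps)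
  ultimately have "\<bar>T (P x) t - P x t\<bar> < e" if "t \<in> {0..1}" for t
    using that by (smt (verit) field_sum_of_halves)
  moreover have "P x \<in> B R" by (rule PB) (use x in auto)
  ultimately show ?thesis using that[of "P x"] by blast
qed

text \<open>The images \<open>T (v n)\<close> of approximate fixed points are bounded and
  equi-Lipschitz, so by Arzela-Ascoli a subsequence converges uniformly to some \<open>g\<close>.
  The corresponding \<open>v n\<close> have the same limit, being within \<open>1 / Suc n\<close> of
  their images, and the continuity of \<open>T\<close> makes \<open>g\<close> a fixed point.\<close>

lemma fixed_point_of_lipschitz_range:
  fixes T :: "(real \<Rightarrow> real) \<Rightarrow> real \<Rightarrow> real"
  defines "B \<equiv> \<lambda>R. {u. continuous_on {0..1} u \<and> u ` {0..1} \<subseteq> {0..R}}"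
  assumes "R > 0"
    and maps: "\<And>u t. u \<in> B R \<Longrightarrow> t \<in> {0..1} \<Longrightarrow> T u t \<in> {0..R}"
    and lip: "\<And>u s t. u \<in> B R \<Longrightarrow> s \<in> {0..1} \<Longrightarrow> t \<in> {0..1} \<Longrightarrow> \<bar>T u s - T u t\<bar> \<le> L * \<bar>s - t\<bar>"
    and uc: "\<And>e. e > 0 \<Longrightarrow> \<exists>d>0. \<forall>u\<in>B R. \<forall>v\<in>B R. (\<forall>t\<in>{0..1}. \<bar>u t - v t\<bar> \<le> d)
               \<longrightarrow> (\<forall>t\<in>{0..1}. \<bar>T u t - T v t\<bar> < e)"
  obtains u where "u \<in> B R" "\<And>t. t \<in> {0..1} \<Longrightarrow> T u t = u t"
proof -
  have "\<exists>v. v \<in> B R \<and> (\<forall>t\<in>{0..1}. \<bar>T v t - v t\<bar> < 1 / Suc n)" for n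
    by (rule approx_fixed_point[OF \<open>R > 0\<close>, of T L "1 / Suc n"])
       (use maps lip uc in \<open>auto simp: B_def\<close>)
  then obtain v where vB: "\<And>n. v n \<in> B R" and v: "\<And>n t. t \<in> {0..1} \<Longrightarrow> \<bar>T (v n) t - v n t\<bar> < 1 / Suc n"
    by metis
  have "L \<ge> 0" using lip[OF vB[of 0], of 0 1] by auto
  obtain g k where g: "continuous_on {0..1::real} g" and k: "strict_mono (k :: nat \<Rightarrow> nat)"
    and lim: "\<And>e. 0 < e \<Longrightarrow> \<exists>N. \<forall>n x. n \<ge> N \<and> x \<in> {0..1} \<longrightarrow> norm (T (v (k n)) x - g x) < e"
  proof (rule Arzela_Ascoli[of "{0..1::real}" "\<lambda>n. T (v n)" R])
    show "norm (T (v n) x) \<le> R" if "x \<in> {0..1}" for n x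
      using maps[OF vB that] by auto
    fix x e :: real assume "x \<in> {0..1}" "e > 0"
    show "\<exists>d>0. \<forall>n y. y \<in> {0..1} \<and> norm (x - y) < d \<longrightarrow> norm (T (v n) x - T (v n) y) < e"
    proof (intro exI[of _ "e / (L + 1)"] conjI allI impI)
      fix n y assume y: "y \<in> {0..1} \<and> norm (x - y) < e / (L + 1)"
      have "norm (T (v n) x - T (v n) y) \<le> L * \<bar>x - y\<bar>"
        using lip[OF vB \<open>x \<in> {0..1}\<close>] y by auto
      also have "\<dots> \<le> L * (e / (L + 1))" using y \<open>L \<ge> 0\<close> by (intro mult_left_mono) auto
      also have "\<dots> < e" using \<open>L \<ge> 0\<close> \<open>e > 0\<close> by (simp add: divide_simps)
      finally show "norm (T (v n) x - T (v n) y) < e" .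
    qed (use \<open>L \<ge> 0\<close> \<open>e > 0\<close> in auto)
  qed auto
  have near: "\<exists>n. (\<forall>t\<in>{0..1}. \<bar>T (v n) t - g t\<bar> < e) \<and> (\<forall>t\<in>{0..1}. \<bar>v n t - g t\<bar> < e)"
    if "e > 0" for e
  proof -
    obtain N where N: "\<forall>n x. n \<ge> N \<and> x \<in> {0..1} \<longrightarrow> \<bar>T (v (k n)) x - g x\<bar> < e / 2"
      using lim[of "e / 2"] \<open>e > 0\<close> by auto
    obtain M :: nat where M: "M > 0" "1 / M < e / 2"
      using real_arch_inverse[of "e / 2"] \<open>e > 0\<close> by (auto simp: field_simps)
    let ?n = "max N M"
    have "k ?n \<ge> M" using seq_suble[OF k, of ?n] by auto
    hence "1 / Suc (k ?n) < e / 2"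
      using M by (smt (verit) frac_le of_nat_0_less_iff of_nat_Suc of_nat_mono)
    hence "\<bar>T (v (k ?n)) t - v (k ?n) t\<bar> < e / 2" if "t \<in> {0..1}" for t
      using v[OF that, of "k ?n"] by linarith
    moreover have "\<bar>T (v (k ?n)) t - g t\<bar> < e / 2" if "t \<in> {0..1}" for t
      using N that by auto
    ultimately show ?thesis using \<open>e > 0\<close>
      by (intro exI[of _ "k ?n"]) (smt (verit, best) field_sum_of_halves)
  qed
  have "g t \<in> {0..R}" if t: "t \<in> {0..1}" for t
  proof -
    have "g t \<ge> - e \<and> g t \<le> R + e" if "e > 0" for e
      using near[OF that] maps[OF vB t] t by (smt (verit) atLeastAtMost_iff)
    hence "0 \<le> g t + e" "g t \<le> R + e" if "e > 0" for e
      using that by fastforce+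
    hence "0 \<le> g t" "g t \<le> R" by (blast intro: field_le_epsilon)+
    thus ?thesis by auto
  qed
  hence gB: "g \<in> B R" using g by (auto simp: B_def)
  moreover have "T g t = g t" if t: "t \<in> {0..1}" for t
  proof -
    have "\<bar>T g t - g t\<bar> < 2 * e" if "e > 0" for e
    proof -
      obtain d where d: "d > 0" "\<And>u w. u \<in> B R \<Longrightarrow> w \<in> B R \<Longrightarrow> (\<forall>t\<in>{0..1}. \<bar>u t - w t\<bar> \<le> d) \<Longrightarrow>
          \<bar>T u t - T w t\<bar> < e" using uc[OF \<open>e > 0\<close>] t by meson
      obtain n where n: "\<forall>t\<in>{0..1}. \<bar>T (v n) t - g t\<bar> < min d e" "\<forall>t\<in>{0..1}. \<bar>v n t - g t\<bar> < min d e"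
        using near[of "min d e"] d \<open>e > 0\<close> by auto
      hence "\<bar>T (v n) t - T g t\<bar> < e" using d(2)[OF vB gB, of n] by force
      moreover have "\<bar>T (v n) t - g t\<bar> < e" using n t by auto
      ultimately show ?thesis by linarith
    qed
    \<comment> \<open>For this \<open>e\<close> the bound \<open>2 * e\<close> is the bounded
      quantity itself, so the strict inequality is contradictory unless that quantity is 0.\<close>
    from this[of "\<bar>T g t - g t\<bar> / 2"] show ?thesis by (cases "T g t = g t") auto
  qed
  ultimately show ?thesis using that by blast
qed

section \<open>Fractional integrals of nonnegative functions\<close>

lemma has_integral_indicator_mult:
  fixes f :: "real \<Rightarrow> real"
  shows "((\<lambda>x. indicator S x * f x) has_integral I) UNIV \<longleftrightarrow> (f has_integral I) S"
proof -
  have "(\<lambda>x. indicator S x * f x) = (\<lambda>x. if x \<in> S then f x else 0)" by (auto simp: indicator_def)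
  thus ?thesis by (simp only: has_integral_restrict_UNIV)
qed

text \<open>Riemann-Liouville integrals of nonnegative functions take values in \<open>ennreal\<close>, so that
  Tonelli's theorem gives the semigroup law without integrability side conditions. At \<open>s = t\<close> the
  kernel has the junk value 0, which does not affect the integral.\<close>

definition frac_nn :: "real \<Rightarrow> (real \<Rightarrow> ennreal) \<Rightarrow> real \<Rightarrow> ennreal" where
  "frac_nn b g t = (\<integral>\<^sup>+s. ennreal ((t - s) powr (b - 1) / Gamma b) * g s * indicator {0..t} s \<partial>lborel)"

lemma frac_nn_measurable [measurable]:
  assumes [measurable]: "g \<in> borel_measurable borel"
  shows "frac_nn b g \<in> borel_measurable borel"
proof -
  \<comment> \<open>The domain \<open>{0..t}\<close> moves with \<open>t\<close>; as a condition on
    the pair of variables it leaves the integrand jointly measurable.\<close>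
  have eq: "frac_nn b g = (\<lambda>t. \<integral>\<^sup>+s. ennreal ((t - s) powr (b - 1) / Gamma b) * g s *
              (if 0 \<le> s \<and> s \<le> t then 1 else 0) \<partial>lborel)"
    by (auto simp: frac_nn_def indicator_def fun_eq_iff intro!: nn_integral_cong)
  show ?thesis unfolding eq by measurable
qed

text \<open>Substituting \<open>r = s + (t - s) * x\<close> leaves the Beta integral with parameters
  \<open>b\<close> and \<open>a\<close>, and
  \<open>Beta b a = Gamma b * Gamma a / Gamma (a + b)\<close> supplies the constant.\<close>

lemma abel_kernel_convolution:
  assumes ab: "a > 0" "b > 0" and "s \<le> t"
  shows "(\<integral>\<^sup>+r. ennreal ((t - r) powr (a - 1) / Gamma a) * ennreal ((r - s) powr (b - 1) / Gamma b) *
            indicator {s..t} r \<partial>lborel) = ennreal ((t - s) powr (a + b - 1) / Gamma (a + b))"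
proof (cases "s = t")
  \<comment> \<open>\<open>0 powr x\<close> is 0 for every \<open>x\<close>, so both sides
    vanish.\<close>
  case True
  have "(\<integral>\<^sup>+r. ennreal ((t - r) powr (a - 1) / Gamma a) * ennreal ((r - s) powr (b - 1) / Gamma b) *
            indicator {s..t} r \<partial>lborel) = (\<integral>\<^sup>+(r::real). 0 \<partial>lborel)"
    by (rule nn_integral_cong) (auto simp: True indicator_def)
  thus ?thesis by (simp add: True)
next
  case False
  with \<open>s \<le> t\<close> have c: "t - s > 0" by simp
  let ?c = "t - s" and ?g = "\<lambda>x. x powr (b - 1) * (1 - x) powr (a - 1)"
  have G: "Gamma a > 0" "Gamma b > 0" "Gamma (a + b) > 0" using ab by auto
  let ?C = "?c powr (a - 1) * ?c powr (b - 1) / (Gamma a * Gamma b)"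
  have C: "?C \<ge> 0" using G by simp
  let ?f = "\<lambda>r. ennreal ((t - r) powr (a - 1) / Gamma a) * ennreal ((r - s) powr (b - 1) / Gamma b) *
            indicator {s..t} r"
  have "(\<integral>\<^sup>+r. ?f r \<partial>lborel) = ennreal \<bar>?c\<bar> * (\<integral>\<^sup>+x. ?f (s + ?c * x) \<partial>lborel)"
    by (rule nn_integral_real_affine) (use c in auto)
  also have "(\<integral>\<^sup>+x. ?f (s + ?c * x) \<partial>lborel) = (\<integral>\<^sup>+x. ennreal ?C * ennreal (indicator {0..1} x * ?g x) \<partial>lborel)"
  proof (rule nn_integral_cong)
    fix x :: real
    have "s + d \<in> {s..t} \<longleftrightarrow> 0 \<le> d \<and> d \<le> ?c" for d by auto
    from this[of "?c * x"] have mem: "s + ?c * x \<in> {s..t} \<longleftrightarrow> x \<in> {0..1}"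
      using c by (simp only: zero_le_mult_iff mult_le_cancel_left2) auto
    show "?f (s + ?c * x) = ennreal ?C * ennreal (indicator {0..1} x * ?g x)"
    proof (cases "x \<in> {0..1}")
      case True
      have e: "t - (s + ?c * x) = ?c * (1 - x)" by (simp add: algebra_simps)
      have "(t - (s + ?c * x)) powr (a - 1) = ?c powr (a - 1) * (1 - x) powr (a - 1)"
        unfolding e by (rule powr_mult)
      moreover have "(s + ?c * x - s) powr (b - 1) = ?c powr (b - 1) * x powr (b - 1)"
        using c True by (simp add: powr_mult)
      ultimately show ?thesis using True mem G
        by (simp add: ennreal_mult'[symmetric] field_simps)
    next
      case False
      thus ?thesis using mem by simp
    qed
  qed
  also have "\<dots> = ennreal ?C * (\<integral>\<^sup>+x. ennreal (indicator {0..1} x * ?g x) \<partial>lborel)"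
    by (rule nn_integral_cmult) simp
  also have "(\<integral>\<^sup>+x. ennreal (indicator {0..1} x * ?g x) \<partial>lborel) = ennreal (Beta b a)"
    by (rule nn_integral_has_integral_lborel) (use has_integral_Beta_real[OF ab(2,1)] in \<open>auto simp: has_integral_indicator_mult\<close>)
  also have "ennreal \<bar>?c\<bar> * (ennreal ?C * ennreal (Beta b a)) = ennreal (?c * (?C * Beta b a))"
    using c C G by (subst ennreal_mult' [symmetric], simp)+ simp
  also have "?c * (?C * Beta b a) = ?c powr (a + b - 1) / Gamma (a + b)"
  proof -
    have "?c powr (a + b - 1) = ?c powr (1 + ((a - 1) + (b - 1)))" by (simp add: algebra_simps)
    also have "\<dots> = ?c * (?c powr (a - 1) * ?c powr (b - 1))"
      using c by (simp only: powr_add) simp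
    finally show ?thesis using G by (simp add: Beta_def add.commute field_simps)
  qed
  finally show ?thesis .
qed

text \<open>Tonelli's theorem exchanges the integrals over the triangle
  \<open>0 \<le> s \<le> r \<le> t\<close>; the inner one is then the convolution of two Abel
  kernels.\<close>

lemma frac_nn_semigroup:
  assumes [measurable]: "g \<in> borel_measurable borel" and ab: "a > 0" "b > 0"
  shows "frac_nn a (frac_nn b g) t = frac_nn (a + b) g t"
proof -
  let ?K = "\<lambda>b x. ennreal (x powr (b - 1) / Gamma b)"
  let ?i = "\<lambda>u v. if u \<le> (v::real) then 1 else (0::ennreal)"
  have "frac_nn a (frac_nn b g) t =
      (\<integral>\<^sup>+r. (\<integral>\<^sup>+s. ?K a (t - r) * ?K b (r - s) * g s * (?i 0 s * ?i s r * ?i r t) \<partial>lborel) \<partial>lborel)"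
    unfolding frac_nn_def
  proof (rule nn_integral_cong)
    fix r
    let ?J = "\<integral>\<^sup>+s. ?K b (r - s) * g s * indicator {0..r} s \<partial>lborel"
    have "?K a (t - r) * ?J * indicator {0..t} r = (\<integral>\<^sup>+s. (?K a (t - r) * indicator {0..t} r) *
        (?K b (r - s) * g s * indicator {0..r} s) \<partial>lborel)"
      by (subst nn_integral_cmult) (auto simp: mult_ac)
    also have "\<dots> = (\<integral>\<^sup>+s. ?K a (t - r) * ?K b (r - s) * g s * (?i 0 s * ?i s r * ?i r t) \<partial>lborel)"
      by (rule nn_integral_cong) (auto simp: indicator_def mult_ac)
    finally show "?K a (t - r) * ?J * indicator {0..t} r = \<dots>" .
  qed
  also have "\<dots> = (\<integral>\<^sup>+s. (\<integral>\<^sup>+r. ?K a (t - r) * ?K b (r - s) * g s * (?i 0 s * ?i s r * ?i r t) \<partial>lborel) \<partial>lborel)"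
    by (rule lborel_pair.Fubini') measurable
  also have "\<dots> = frac_nn (a + b) g t"
    unfolding frac_nn_def
  proof (rule nn_integral_cong)
    fix s
    show "(\<integral>\<^sup>+r. ?K a (t - r) * ?K b (r - s) * g s * (?i 0 s * ?i s r * ?i r t) \<partial>lborel) =
          ?K (a + b) (t - s) * g s * indicator {0..t} s"
    proof (cases "0 \<le> s \<and> s \<le> t")
      case True
      have "(\<integral>\<^sup>+r. ?K a (t - r) * ?K b (r - s) * g s * (?i 0 s * ?i s r * ?i r t) \<partial>lborel) =
            (\<integral>\<^sup>+r. g s * (?K a (t - r) * ?K b (r - s) * indicator {s..t} r) \<partial>lborel)"
        by (rule nn_integral_cong) (use True in \<open>auto simp: indicator_def mult_ac\<close>)
      also have "\<dots> = g s * (\<integral>\<^sup>+r. ?K a (t - r) * ?K b (r - s) * indicator {s..t} r \<partial>lborel)"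
        by (rule nn_integral_cmult) measurable
      also have "\<dots> = g s * ?K (a + b) (t - s)"
        using abel_kernel_convolution[OF ab, of s t] True by simp
      finally show ?thesis using True by (simp add: mult_ac)
    next
      case False
      hence "(\<integral>\<^sup>+r. ?K a (t - r) * ?K b (r - s) * g s * (?i 0 s * ?i s r * ?i r t) \<partial>lborel) = (\<integral>\<^sup>+(r::real). 0 \<partial>lborel)"
        by (intro nn_integral_cong) auto
      thus ?thesis using False by auto
    qed
  qed
  finally show ?thesis .
qed

lemma frac_nn_one: "frac_nn 1 g t = (\<integral>\<^sup>+s. g s * indicator {0..t} s \<partial>lborel)"
  unfolding frac_nn_def
proof (rule nn_integral_cong_AE, rule AE_mp[OF AE_lborel_singleton[of t]], rule AE_I2, rule impI)
  fix s assume "s \<noteq> t"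
  thus "ennreal ((t - s) powr (1 - 1) / Gamma 1) * g s * indicator {0..t} s = g s * indicator {0..t} s"
    by (auto simp: indicator_def)
qed

text \<open>The passage from \<open>ennreal\<close> to real integrals. A finite value forces
  \<open>g\<close> to be finite at almost every point where the kernel is positive, and elsewhere
  both integrands are 0, so \<open>enn2real\<close> loses nothing.\<close>

lemma frac_nn_has_integral:
  fixes g :: "real \<Rightarrow> ennreal"
  assumes [measurable]: "g \<in> borel_measurable borel" and b: "b > 0"
    and r: "frac_nn b g t = ennreal r" "r \<ge> 0"
  shows "((\<lambda>s. (t - s) powr (b - 1) / Gamma b * enn2real (g s)) has_integral r) {0..t}"
proof -
  let ?f = "\<lambda>s. indicator {0..t} s * ((t - s) powr (b - 1) / Gamma b * enn2real (g s))"
  let ?F = "\<lambda>s. ennreal ((t - s) powr (b - 1) / Gamma b) * g s * indicator {0..t} s"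
  have G: "Gamma b > 0" using b by simp
  have "AE s in lborel. ?F s \<noteq> \<infinity>"
    by (rule nn_integral_noteq_infinite) (use r in \<open>simp_all add: frac_nn_def\<close>)
  hence "AE s in lborel. ennreal (?f s) = ?F s"
  proof (rule AE_mp, intro AE_I2 impI)
    fix s assume fin: "?F s \<noteq> \<infinity>"
    show "ennreal (?f s) = ?F s"
    proof (cases "s \<in> {0..t} \<and> (t - s) powr (b - 1) / Gamma b > 0")
      case True
      hence "g s \<noteq> \<infinity>" using fin by (auto simp: ennreal_mult_eq_top_iff)
      then obtain x where "g s = ennreal x" "x \<ge> 0" by (cases "g s") auto
      thus ?thesis using True G by (simp add: ennreal_mult'' [symmetric])
    next
      case False
      hence "s \<notin> {0..t} \<or> (t - s) powr (b - 1) = 0"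
        using G by (metis divide_pos_pos powr_ge_zero order_le_less)
      thus ?thesis by auto
    qed
  qed
  hence "(\<integral>\<^sup>+s. ennreal (?f s) \<partial>lborel) = (\<integral>\<^sup>+s. ?F s \<partial>lborel)"
    by (rule nn_integral_cong_AE)
  hence "(?f has_integral r) UNIV"
    using r G by (intro nn_integral_has_integral) (auto simp: frac_nn_def)
  thus ?thesis by (simp only: has_integral_indicator_mult)
qed

lemma frac_nn_one_has_integral:
  fixes g :: "real \<Rightarrow> ennreal"
  assumes "g \<in> borel_measurable borel" "frac_nn 1 g t = ennreal r" "r \<ge> 0"
  shows "((\<lambda>s. enn2real (g s)) has_integral r) {0..t}"
  by (rule has_integral_spike_finite[OF _ _ frac_nn_has_integral[OF assms(1) zero_less_one assms(2,3)],
        of "{t}"]) auto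

section \<open>Differentiation and absolute continuity of indefinite integrals\<close>

text \<open>The library result on averages over \<open>[x, x + h]\<close> yields the right derivative; applied to the
  reflected function it yields the left one.\<close>

lemma indefinite_integral_derivative_ae:
  fixes h :: "real \<Rightarrow> real"
  assumes h: "h integrable_on {a..b}"
  obtains N where "negligible N"
    "\<And>t. t \<in> {a<..<b} - N \<Longrightarrow> ((\<lambda>t. integral {a..t} h) has_real_derivative h t) (at t)"
proof -
  \<comment> \<open>The extension by 0 is integrable over every interval, as the result on averages
    requires.\<close>
  define f where "f = (\<lambda>x. if x \<in> {a..b} then h x else 0)"
  have fU: "f integrable_on UNIV"
    using h unfolding f_def integrable_restrict_UNIV .
  have f: "f integrable_on cbox u v" for u v
    by (rule integrable_on_subcbox[OF fU]) simp
  have f': "(\<lambda>x. f (- x)) integrable_on cbox u v" for u v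
    using integrable_reflect[of f "- u" "- v"] f[of "- v" "- u"] by simp
  obtain N1 where N1: "negligible N1" and lim1: "\<And>x e. \<lbrakk>x \<notin> N1; 0 < e\<rbrakk> \<Longrightarrow>
      \<exists>d>0. \<forall>h. 0 < h \<and> h < d \<longrightarrow> \<bar>integral {x..x + h} f / h - f x\<bar> < e"
    using integrable_ccontinuous_explicit[OF f] by (auto simp: divide_inverse mult.commute)
  obtain N2 where N2: "negligible N2" and lim2: "\<And>x e. \<lbrakk>x \<notin> N2; 0 < e\<rbrakk> \<Longrightarrow>
      \<exists>d>0. \<forall>h. 0 < h \<and> h < d \<longrightarrow> \<bar>integral {x..x + h} (\<lambda>x. f (- x)) / h - f (- x)\<bar> < e"
    using integrable_ccontinuous_explicit[OF f'] by (auto simp: divide_inverse mult.commute)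
  let ?N = "N1 \<union> uminus ` N2"
  have "negligible (uminus ` N2)"
    by (rule negligible_differentiable_image_negligible[OF _ N2])
       (auto intro!: derivative_intros simp: differentiable_on_def)
  hence "negligible ?N" using N1 by simp
  moreover have "((\<lambda>t. integral {a..t} h) has_real_derivative h t) (at t)"
    if t: "t \<in> {a<..<b} - ?N" for t
  proof -
    have ft: "f t = h t" using t by (simp add: f_def)
    have eqf: "integral {u..v} h = integral {u..v} f" if "a \<le> u" "v \<le> b" for u v
      by (rule integral_cong) (use that in \<open>auto simp: f_def\<close>)
    have "(\<lambda>d. (integral {a..t + d} h - integral {a..t} h) / d) \<midarrow>0\<rightarrow> h t"
    proof (rule LIM_I)
      fix e :: real assume "e > 0"
      obtain d1 where d1: "d1 > 0" "\<And>d. 0 < d \<Longrightarrow> d < d1 \<Longrightarrow> \<bar>integral {t..t + d} f / d - f t\<bar> < e"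
        using lim1[of t e] t \<open>e > 0\<close> by auto
      have "- t \<notin> N2" using t by force
      then obtain d2 where d2: "d2 > 0"
        "\<And>d. 0 < d \<Longrightarrow> d < d2 \<Longrightarrow> \<bar>integral {- t..- t + d} (\<lambda>x. f (- x)) / d - f t\<bar> < e"
        using lim2[of "- t" e] \<open>e > 0\<close> by auto
      \<comment> \<open>The entries \<open>t - a\<close> and \<open>b - t\<close> keep
        \<open>t + d\<close> inside \<open>{a..b}\<close>, where \<open>f\<close> and
        \<open>h\<close> agree.\<close>
      define s where "s = Min {d1, d2, t - a, b - t}"
      have s: "s > 0" "s \<le> d1" "s \<le> d2" "s \<le> t - a" "s \<le> b - t"
        using d1 d2 t by (auto simp: s_def)
      have "norm ((integral {a..t + d} h - integral {a..t} h) / d - h t) < e"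
        if d: "d \<noteq> 0" "norm (d - 0) < s" for d
      proof (cases "d > 0")
        case True
        have "integral {a..t} h + integral {t..t + d} h = integral {a..t + d} h"
          by (rule Henstock_Kurzweil_Integration.integral_combine) (use True d s t in \<open>auto intro: integrable_on_subinterval[OF h]\<close>)
        moreover have "integral {t..t + d} h = integral {t..t + d} f" using t d s by (intro eqf) auto
        ultimately have "integral {a..t + d} h - integral {a..t} h = integral {t..t + d} f" by simp
        thus ?thesis using d1(2)[of d] True d s by (simp add: ft)
      next
        case False
        hence neg: "d < 0" using d by simp
        have "integral {a..t + d} h + integral {t + d..t} h = integral {a..t} h"
          by (rule Henstock_Kurzweil_Integration.integral_combine) (use neg d s t in \<open>auto intro: integrable_on_subinterval[OF h]\<close>)
        moreover have "integral {t + d..t} h = integral {t + d..t} f" using t d s neg by (intro eqf) auto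
        moreover have "integral {- t..- t + (- d)} (\<lambda>x. f (- x)) = integral {t + d..t} f"
          using Henstock_Kurzweil_Integration.integral_reflect_real[of t "t + d" f] by simp
        ultimately have "integral {a..t + d} h - integral {a..t} h =
            - integral {- t..- t + (- d)} (\<lambda>x. f (- x))" by simp
        thus ?thesis using d2(2)[of "- d"] neg d s by (simp add: ft)
      qed
      thus "\<exists>s>0. \<forall>x. x \<noteq> 0 \<and> norm (x - 0) < s \<longrightarrow>
          norm ((integral {a..t + x} h - integral {a..t} h) / x - h t) < e"
        using s(1) by blast
    qed
    thus ?thesis by (simp add: DERIV_def)
  qed
  ultimately show ?thesis using that by blast
qed

text \<open>Absolute continuity of the integral by truncation: by dominated convergence, the excess
  of \<open>h\<close> over a large level \<open>n\<close> has integral below \<open>e / 2\<close> on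
  the whole interval, while the truncated part contributes at most \<open>n\<close> times the total
  length.\<close>

lemma abs_continuous_of_integral_bound:
  fixes g h :: "real \<Rightarrow> real"
  assumes h: "h integrable_on {0..1}" and nonneg: "\<And>t. t \<in> {0..1} \<Longrightarrow> h t \<ge> 0"
    and g: "\<And>s t. 0 \<le> s \<Longrightarrow> s \<le> t \<Longrightarrow> t \<le> 1 \<Longrightarrow> \<bar>g t - g s\<bar> \<le> integral {s..t} h"
  shows "abs_continuous g"
  unfolding abs_continuous_def
proof (intro allI impI)
  fix e :: real assume "e > 0"
  define f where "f n x = min (h x) (real n)" for n x
  have abs: "h absolutely_integrable_on {0..1}"
    using h nonneg by (rule nonnegative_absolutely_integrable_1)
  have fint: "f n integrable_on {0..1}" for n
  proof -
    have "(\<lambda>x. \<Sum>i\<in>Basis. min (h x \<bullet> i) (real n \<bullet> i) *\<^sub>R i) absolutely_integrable_on {0..1}"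
      by (rule absolutely_integrable_min[OF abs]) (simp add: nonnegative_absolutely_integrable_1)
    thus ?thesis by (simp add: f_def[abs_def] absolutely_integrable_on_def)
  qed
  have lim: "(\<lambda>n. integral {0..1} (f n)) \<longlonglongrightarrow> integral {0..1} h"
  proof (rule dominated_convergence(2)[OF fint h])
    show "norm (f n x) \<le> h x" if "x \<in> {0..1}" for n x using nonneg[OF that] by (simp add: f_def)
    show "(\<lambda>n. f n x) \<longlonglongrightarrow> h x" if "x \<in> {0..1}" for x
    proof (rule tendsto_eventually)
      show "\<forall>\<^sub>F n in sequentially. f n x = h x"
        using eventually_ge_at_top[of "nat \<lceil>h x\<rceil>"]
        by eventually_elim (auto simp: f_def min_def nat_le_iff ceiling_le_iff)
    qed
  qed
  obtain n where n: "integral {0..1} h - integral {0..1} (f n) < e / 2"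
    using LIMSEQ_D[OF lim, of "e / 2"] \<open>e > 0\<close> by (force simp: abs_if split: if_splits)
  let ?r = "\<lambda>x. h x - f n x"
  have r: "?r integrable_on {0..1}" using h fint by (rule integrable_diff)
  show "\<exists>\<delta>>0. \<forall>D. D division_of \<Union>D \<and> \<Union>D \<subseteq> {0..1} \<and> (\<Sum>K\<in>D. Sup K - Inf K) < \<delta> \<longrightarrow>
        (\<Sum>K\<in>D. \<bar>g (Sup K) - g (Inf K)\<bar>) < e"
  \<comment> \<open>At this total length the truncated part contributes at most
    \<open>e / 2\<close>; \<open>real n + 1\<close> avoids a division by 0.\<close>
  proof (intro exI[of _ "e / (2 * (real n + 1))"] conjI allI impI)
    show "e / (2 * (real n + 1)) > 0" using \<open>e > 0\<close> by simp
    fix D :: "real set set"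
    assume D: "D division_of \<Union>D \<and> \<Union>D \<subseteq> {0..1} \<and> (\<Sum>K\<in>D. Sup K - Inf K) < e / (2 * (real n + 1))"
    have bound: "\<bar>g (Sup K) - g (Inf K)\<bar> \<le> integral K ?r + real n * (Sup K - Inf K)" if K: "K \<in> D" for K
    proof -
      obtain a b where ab: "K = {a..b}" "a \<le> b" "0 \<le> a" "b \<le> 1"
      proof -
        have "K \<subseteq> {0..1}" "K \<noteq> {}" using D K by (auto dest: division_ofD(3))
        moreover obtain a b where "K = cbox a b" using D K by (meson division_ofD(4))
        ultimately show ?thesis using that[of a b] by auto
      qed
      have sub: "\<phi> integrable_on {a..b}" if "\<phi> integrable_on {0..1}" for \<phi> :: "real \<Rightarrow> real"
        by (rule integrable_on_subinterval[OF that]) (use ab in auto)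
      have "\<bar>g b - g a\<bar> \<le> integral {a..b} h" using ab by (intro g) auto
      also have "\<dots> = integral {a..b} ?r + integral {a..b} (f n)"
        using integral_diff[OF sub[OF h] sub[OF fint], of n] by simp
      also have "integral {a..b} (f n) \<le> integral {a..b} (\<lambda>_. real n)"
        by (rule integral_le[OF sub[OF fint]]) (auto simp: f_def)
      finally show ?thesis using ab by (simp add: mult.commute)
    qed
    have rD: "?r integrable_on \<Union>D" using D by (intro integrable_on_subdivision[OF _ r]) auto
    have "(\<Sum>K\<in>D. \<bar>g (Sup K) - g (Inf K)\<bar>) \<le> (\<Sum>K\<in>D. integral K ?r + real n * (Sup K - Inf K))"
      by (rule sum_mono) (rule bound)
    also have "\<dots> = (\<Sum>K\<in>D. integral K ?r) + real n * (\<Sum>K\<in>D. Sup K - Inf K)"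
      by (simp add: sum.distrib sum_distrib_left)
    also have "(\<Sum>K\<in>D. integral K ?r) = integral (\<Union>D) ?r"
      using D by (intro integral_combine_division_topdown [symmetric] rD) auto
    also have "\<dots> \<le> integral {0..1} ?r"
      using D by (intro integral_subset_le r rD) (auto simp: f_def)
    also have "\<dots> < e / 2" using n by (simp add: integral_diff[OF h fint])
    also have "real n * (\<Sum>K\<in>D. Sup K - Inf K) \<le> real n * (e / (2 * (real n + 1)))"
      using D by (intro mult_left_mono) auto
    also have "\<dots> \<le> e / 2" using \<open>e > 0\<close> by (simp add: divide_simps)
    finally show "(\<Sum>K\<in>D. \<bar>g (Sup K) - g (Inf K)\<bar>) < e" by simp
  qed
qed

section \<open>Real-valued fractional integrals of a density\<close>

lemma powr_div_Gamma_le: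
  fixes x b :: real
  assumes "x \<in> {0..1}" "b \<ge> 1"
  shows "x powr (b - 1) / Gamma b \<le> 1 / Gamma b" "0 \<le> x powr (b - 1) / Gamma b"
  using assms powr_mono2[of "b - 1" x 1] by (auto intro!: divide_right_mono)

text \<open>\<open>J b\<close> is the integral of order \<open>b\<close> of the density \<open>k\<close>, hence the integral of order \<open>b - 1\<close> of \<open>y\<close>.
  Monotonicity, scaling and regularity of the latter are read off the former.\<close>

locale nonneg_density =
  fixes k y :: "real \<Rightarrow> real"
  assumes k_measurable [measurable]: "k \<in> borel_measurable borel"
    and k_nonneg: "k t \<ge> 0"
    and y: "t \<in> {0..1} \<Longrightarrow> (k has_integral y t) {0..t}"
begin

definition J :: "real \<Rightarrow> real \<Rightarrow> real" where
  "J b t = enn2real (frac_nn b (\<lambda>s. ennreal (k s)) t)"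

lemma y_nonneg: "t \<in> {0..1} \<Longrightarrow> y t \<ge> 0"
  using has_integral_nonneg[OF y] k_nonneg by blast

lemma y_eq: "t \<in> {0..1} \<Longrightarrow> frac_nn 1 (\<lambda>s. ennreal (k s)) t = ennreal (y t)"
proof -
  assume t: "t \<in> {0..1}"
  have "((\<lambda>s. indicator {0..t} s * k s) has_integral y t) UNIV"
    using y[OF t] by (simp only: has_integral_indicator_mult)
  hence "(\<integral>\<^sup>+s. ennreal (indicator {0..t} s * k s) \<partial>lborel) = ennreal (y t)"
    by (intro nn_integral_has_integral_lborel) (use k_nonneg in auto)
  thus ?thesis by (simp add: frac_nn_one ennreal_mult'' ennreal_indicator mult.commute)
qed

text \<open>For \<open>b \<ge> 1\<close> the kernel is bounded on [0,1], so the integral is finite.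
  For \<open>b < 1\<close> it may be infinite at some points, where \<open>J b\<close> has the
  default value 0.\<close>

lemma frac_nn_J:
  assumes t: "t \<in> {0..1}" and b: "b \<ge> 1"
  shows "frac_nn b (\<lambda>s. ennreal (k s)) t = ennreal (J b t)"
proof -
  have "Gamma b > 0" using b by simp
  have "frac_nn b (\<lambda>s. ennreal (k s)) t \<le> 
      (\<integral>\<^sup>+s. ennreal (1 / Gamma b) * (ennreal (k s) * indicator {0..t} s) \<partial>lborel)"
    unfolding frac_nn_def
  proof (rule nn_integral_mono)
    fix s
    show "ennreal ((t - s) powr (b - 1) / Gamma b) * ennreal (k s) * indicator {0..t} s
        \<le> ennreal (1 / Gamma b) * (ennreal (k s) * indicator {0..t} s)"
      unfolding mult.assoc
      using powr_div_Gamma_le[of "t - s" b] t b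
      by (cases "s \<in> {0..t}") (auto intro!: mult_right_mono ennreal_leI)
  qed
  also have "\<dots> = ennreal (1 / Gamma b) * ennreal (y t)"
    using y_eq[OF t] by (simp add: nn_integral_cmult frac_nn_one)
  also have "\<dots> < \<infinity>" by (simp add: ennreal_mult_less_top)
  finally show ?thesis by (simp add: J_def)
qed

lemma J_nonneg: "J b t \<ge> 0" by (simp add: J_def)

lemma J_one: "t \<in> {0..1} \<Longrightarrow> J 1 t = y t"
  using y_eq y_nonneg by (simp add: J_def)

text \<open>Only the total order has to reach 1: the value of order \<open>a + b\<close> is then
  finite, which makes the integral of order \<open>b\<close> finite almost everywhere on
  \<open>{0..t}\<close>, even when \<open>b < 1\<close>.\<close>

lemma J_frac_has_integral:
  assumes "t \<in> {0..1}" "a > 0" "b > 0" "a + b \<ge> 1"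
  shows "((\<lambda>s. (t - s) powr (a - 1) / Gamma a * J b s) has_integral J (a + b) t) {0..t}"
  unfolding J_def[of b]
proof (rule frac_nn_has_integral)
  show "frac_nn a (\<lambda>s. frac_nn b (\<lambda>s. ennreal (k s)) s) t = ennreal (J (a + b) t)"
    using frac_nn_J[OF assms(1,4)] assms by (simp add: frac_nn_semigroup)
qed (use assms J_nonneg in auto)

lemma J_has_integral:
  assumes "t \<in> {0..1}" "b > 0"
  shows "(J b has_integral J (b + 1) t) {0..t}"
  by (rule has_integral_spike_finite[OF _ _ J_frac_has_integral[of t 1 b, unfolded add.commute[of 1 b]], of "{t}"])
     (use assms in auto)

lemma J_kernel_has_integral:
  assumes "t \<in> {0..1}" "b \<ge> 1"
  shows "((\<lambda>s. (t - s) powr (b - 1) / Gamma b * k s) has_integral J b t) {0..t}"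
  using frac_nn_has_integral[of "\<lambda>s. ennreal (k s)" b t "J b t"]
    frac_nn_J[OF assms] assms J_nonneg k_nonneg by simp

lemma J_integral_density:
  assumes "t \<in> {0..1}" "b > 0"
  shows "((\<lambda>s. (t - s) powr (b - 1) / Gamma b * y s) has_integral J (b + 1) t) {0..t}"
  by (rule has_integral_eq[OF _ J_frac_has_integral[of t b 1]]) (use assms in \<open>auto simp: J_one\<close>)

lemma J_eq_integral:
  assumes "t \<in> {0..1}" "b > 0"
  shows "J (b + 1) t = integral {0..t} (J b)"
  using J_has_integral[OF assms] by (simp add: integral_unique)

lemma J_integrable: "b > 0 \<Longrightarrow> J b integrable_on {0..1}"
  using J_has_integral[of 1 b] by auto

lemma continuous_on_y: "continuous_on {0..1} y"
proof (rule continuous_on_eq)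
  show "continuous_on {0..1} (\<lambda>x. integral {0..x} k)"
    by (rule indefinite_integral_continuous_1) (use y[of 1] in auto)
qed (use y in \<open>auto simp: integral_unique\<close>)

lemma continuous_on_J: "b \<ge> 1 \<Longrightarrow> continuous_on {0..1} (J b)"
proof (cases "b = 1")
  case True
  show ?thesis unfolding True
    by (rule continuous_on_eq[OF continuous_on_y]) (simp add: J_one)
next
  case False
  moreover assume "b \<ge> 1"
  ultimately have b: "b - 1 > 0" by simp
  show ?thesis
  proof (rule continuous_on_eq)
    show "continuous_on {0..1} (\<lambda>t. integral {0..t} (J (b - 1)))"
      by (rule indefinite_integral_continuous_1[OF J_integrable[OF b]])
  qed (use J_eq_integral[OF _ b] in auto)
qed

lemma J_derivative:
  assumes "t \<in> {0..1}" "b \<ge> 1"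
  shows "(J (b + 1) has_vector_derivative J b t) (at t within {0..1})"
proof (rule has_vector_derivative_transform[OF assms(1)])
  show "((\<lambda>t. integral {0..t} (J b)) has_vector_derivative J b t) (at t within {0..1})"
    by (rule integral_has_vector_derivative) (use assms continuous_on_J in auto)
qed (use assms J_eq_integral in auto)

text \<open>For \<open>b < 1\<close> the integrand \<open>J b\<close> need not be continuous, so
  Lebesgue differentiation replaces the fundamental theorem. It concerns interior points, hence the
  end points join the null set.\<close>

lemma J_derivative_ae:
  assumes "b > 0"
  obtains N where "negligible N"
    "\<And>t. t \<in> {0..1} - N \<Longrightarrow> (J (b + 1) has_vector_derivative J b t) (at t within {0..1})"
proof -
  obtain N where N: "negligible N" and
    der: "\<And>t. t \<in> {0<..<1} - N \<Longrightarrow> ((\<lambda>t. integral {0..t} (J b)) has_real_derivative J b t) (at t)"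
    using indefinite_integral_derivative_ae[OF J_integrable[OF assms]] by blast
  have "(J (b + 1) has_vector_derivative J b t) (at t within {0..1})" if "t \<in> {0..1} - (N \<union> {0, 1})" for t
  proof (rule has_vector_derivative_transform)
    have "t \<in> {0<..<1} - N" using that by auto
    thus "((\<lambda>t. integral {0..t} (J b)) has_vector_derivative J b t) (at t within {0..1})"
      using der has_real_derivative_iff_has_vector_derivative has_vector_derivative_at_within by blast
  qed (use that assms J_eq_integral in auto)
  thus ?thesis using that[of "N \<union> {0, 1}"] N by auto
qed

lemma J_zero: "b \<ge> 1 \<Longrightarrow> J b 0 = 0"
  using J_kernel_has_integral[of 0 b] has_integral_refl(1) by (simp add: has_integral_iff)

lemma y_mono:
  assumes "0 \<le> s" "s \<le> t" "t \<le> 1"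
  shows "y s \<le> y t"
  by (rule has_integral_subset_le[OF _ y y]) (use assms k_nonneg in auto)

lemma J_increment:
  assumes "0 \<le> s" "s \<le> t" "t \<le> 1" "b > 0"
  shows "J (b + 1) t - J (b + 1) s = integral {s..t} (J b)"
proof -
  have "J b integrable_on {0..t}" using J_has_integral[of t b] assms by auto
  hence "integral {0..s} (J b) + integral {s..t} (J b) = integral {0..t} (J b)"
    using assms by (intro Henstock_Kurzweil_Integration.integral_combine) auto
  thus ?thesis using assms by (simp add: J_eq_integral)
qed

lemma J_mono:
  assumes "0 \<le> s" "s \<le> t" "t \<le> 1" "b > 1"
  shows "J b s \<le> J b t"
  using J_increment[of s t "b - 1"] integral_nonneg[of "J (b - 1)" "{s..t}"] J_nonneg assms
    integrable_on_subinterval[OF J_integrable, of "b - 1" s t] by simp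

text \<open>For \<open>0 \<le> r \<le> s \<le> 1\<close> one has
  \<open>s - r \<le> s * (1 - r)\<close>, which compares the kernels at \<open>s\<close> and at 1.
  The powers of \<open>\<eta>\<close> and \<open>t\<close> in the cone estimates originate
  here.\<close>

lemma J_scale_le:
  assumes s: "s \<in> {0..1}" and b: "b \<ge> 1"
  shows "J b s \<le> s powr (b - 1) * J b 1"
proof -
  let ?K = "\<lambda>t r. (t - r) powr (b - 1) / Gamma b * k r"
  have G: "Gamma b > 0" using b by simp
  have K1: "(?K 1 has_integral J b 1) {0..1}" by (rule J_kernel_has_integral) (use b in auto)
  have i: "?K 1 integrable_on {0..s}" by (rule integrable_on_subinterval[of _ "{0..1}"]) (use K1 s in auto)
  have "J b s \<le> integral {0..s} (\<lambda>r. s powr (b - 1) * ?K 1 r)"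
  proof (rule has_integral_le[OF J_kernel_has_integral[OF s b] integrable_integral])
    show "(\<lambda>r. s powr (b - 1) * ?K 1 r) integrable_on {0..s}" using i by (rule integrable_on_mult_right)
    fix r assume r: "r \<in> {0..s}"
    have "s - r \<le> s * (1 - r)" using r s mult_right_le_one_le[of r s] by (simp add: algebra_simps mult.commute)
    hence "(s - r) powr (b - 1) \<le> (s * (1 - r)) powr (b - 1)" using r b by (intro powr_mono2) auto
    also have "\<dots> = s powr (b - 1) * (1 - r) powr (b - 1)" by (rule powr_mult)
    finally have "(s - r) powr (b - 1) / Gamma b * k r \<le> s powr (b - 1) * (1 - r) powr (b - 1) / Gamma b * k r"
      using G k_nonneg by (intro mult_right_mono divide_right_mono) auto
    thus "?K s r \<le> s powr (b - 1) * ?K 1 r" by (simp add: mult_ac)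
  qed
  also have "\<dots> = s powr (b - 1) * integral {0..s} (?K 1)" by simp
  also have "integral {0..s} (?K 1) \<le> integral {0..1} (?K 1)"
    by (rule integral_subset_le[OF _ i]) (use K1 s G k_nonneg in auto)
  also have "\<dots> = J b 1" using K1 by (rule integral_unique)
  finally show ?thesis by (simp add: mult_left_mono)
qed

text \<open>\<open>J b\<close> is increasing, so its value at 1 bounds the integrand of
  \<open>J (b + 1)\<close>.\<close>

lemma J_Lipschitz:
  assumes "s \<in> {0..1}" "t \<in> {0..1}" "b > 1"
  shows "\<bar>J (b + 1) s - J (b + 1) t\<bar> \<le> J b 1 * \<bar>s - t\<bar>"
proof -
  have *: "\<bar>J (b + 1) s - J (b + 1) t\<bar> \<le> J b 1 * \<bar>s - t\<bar>" if "0 \<le> s" "s \<le> t" "t \<le> 1" for s t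
  proof -
    have "integral {s..t} (J b) \<le> integral {s..t} (\<lambda>_. J b 1)"
      by (rule integral_le) (use that assms J_mono in \<open>auto intro: integrable_on_subinterval[OF J_integrable]\<close>)
    thus ?thesis using J_increment[of s t b] J_mono[of s t "b + 1"] that assms by (simp add: mult.commute)
  qed
  show ?thesis using *[of s t] *[of t s] assms by (cases "s \<le> t") (auto simp: abs_minus_commute)
qed

end

section \<open>Caputo derivatives of fractional integrals\<close>

lemma nderiv_0: "nderiv 0 g = g"
  by (simp add: nderiv_def)

lemma nderiv_Suc: "nderiv (Suc n) g t = vector_derivative (nderiv n g) (at t within {0..1})"
  by (simp add: nderiv_def)

context nonneg_density
begin

text \<open>The formula for \<open>nderiv n u\<close> is assumed on all of [0,1], but
  \<open>J (b + 1)\<close> is differentiated at a single point, so that the step also covers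
  derivatives known only almost everywhere.\<close>

lemma nderiv_step:
  assumes "\<And>t. t \<in> {0..1} \<Longrightarrow> nderiv n u t = c - J (b + 1) t"
    and "t \<in> {0..1}" and "(J (b + 1) has_vector_derivative J b t) (at t within {0..1})"
  shows "(nderiv n u has_vector_derivative - J b t) (at t within {0..1})"
    and "nderiv (Suc n) u t = - J b t"
proof -
  have "((\<lambda>t. c - J (b + 1) t) has_vector_derivative 0 - J b t) (at t within {0..1})"
    by (intro derivative_intros assms(3))
  thus der: "(nderiv n u has_vector_derivative - J b t) (at t within {0..1})"
    using assms(1,2) by (intro has_vector_derivative_transform[OF assms(2), of "nderiv n u"]) auto
  show "nderiv (Suc n) u t = - J b t"
    unfolding nderiv_Suc using assms(2)
    by (intro vector_derivative_within_closed_interval der) auto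
qed

lemma nderiv_fractional_integral:
  assumes \<alpha>: "2 < \<alpha>" and u: "\<And>t. t \<in> {0..1} \<Longrightarrow> u t = c - J (\<alpha> + 1) t" and t: "t \<in> {0..1}"
  shows "nderiv 1 u t = - J \<alpha> t" "nderiv 2 u t = - J (\<alpha> - 1) t"
    "nderiv 0 u differentiable (at t within {0..1})" "nderiv 1 u differentiable (at t within {0..1})"
proof -
  have step0: "(nderiv 0 u has_vector_derivative - J \<alpha> t) (at t within {0..1})"
     "nderiv (Suc 0) u t = - J \<alpha> t" if "t \<in> {0..1}" for t
    using nderiv_step[of 0 u c \<alpha>, OF _ that J_derivative[OF that]] \<alpha> u by (auto simp: nderiv_0)
  have step1: "(nderiv (Suc 0) u has_vector_derivative - J (\<alpha> - 1) t) (at t within {0..1})"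
     "nderiv (Suc (Suc 0)) u t = - J (\<alpha> - 1) t" if "t \<in> {0..1}" for t
    using nderiv_step[of "Suc 0" u 0 "\<alpha> - 1", OF _ that J_derivative[OF that]] \<alpha> step0(2) by auto
  show "nderiv 1 u t = - J \<alpha> t" "nderiv 2 u t = - J (\<alpha> - 1) t"
    "nderiv 0 u differentiable (at t within {0..1})" "nderiv 1 u differentiable (at t within {0..1})"
    using step0[OF t] step1[OF t] by (auto simp: numeral_2_eq_2 intro: differentiableI_vector)
qed

lemma cont_diff_2_fractional_integral:
  assumes \<alpha>: "2 < \<alpha>" and u: "\<And>t. t \<in> {0..1} \<Longrightarrow> u t = c - J (\<alpha> + 1) t"
  shows "cont_diff 2 u"
proof -
  have "nderiv k u differentiable (at t within {0..1})" if "k < 2" "t \<in> {0..1}" for k t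
  proof -
    have "k = 0 \<or> k = 1" using \<open>k < 2\<close> by auto
    thus ?thesis using nderiv_fractional_integral(3,4)[OF \<alpha> u \<open>t \<in> {0..1}\<close>] by auto
  qed
  moreover have "continuous_on {0..1} (\<lambda>t. - J (\<alpha> - 1) t)"
    using \<alpha> by (intro continuous_intros continuous_on_J) auto
  hence "continuous_on {0..1} (nderiv 2 u)"
    by (rule continuous_on_eq) (use nderiv_fractional_integral(2)[OF \<alpha> u] in auto)
  ultimately show ?thesis by (auto simp: cont_diff_def)
qed

lemma caputo_fractional_integral:
  assumes \<alpha>: "2 < \<alpha>" "\<alpha> \<le> 3" and u: "\<And>t. t \<in> {0..1} \<Longrightarrow> u t = c - J (\<alpha> + 1) t"
  shows "caputo_differentiable \<alpha> u" and "t \<in> {0..1} \<Longrightarrow> caputo \<alpha> u t = - y t"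
proof -
  have "\<lceil>\<alpha>\<rceil> = 3" using \<alpha> by (intro ceiling_unique) auto
  hence n: "nat \<lceil>\<alpha>\<rceil> = 3" by simp
  have three: "3 = Suc 2" by simp
  have d2: "nderiv 2 u t = - J (\<alpha> - 1) t" if "t \<in> {0..1}" for t
    by (rule nderiv_fractional_integral(2)[OF \<alpha>(1) u that])
  note cd2 = cont_diff_2_fractional_integral[OF \<alpha>(1) u]
  have "caputo_differentiable \<alpha> u \<and> (\<forall>t\<in>{0..1}. caputo \<alpha> u t = - y t)"
  proof (cases "\<alpha> = 3")
    \<comment> \<open>Here the third derivative is classical and equals \<open>- J 1\<close>, that
      is \<open>- y\<close>, which is continuous.\<close>
    case True
    have step: "(nderiv 2 u has_vector_derivative - J 1 t) (at t within {0..1})"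
      "nderiv 3 u t = - J 1 t" if "t \<in> {0..1}" for t
      using nderiv_step[of 2 u 0 1, OF _ that J_derivative[OF that]] d2 True by auto
    have "nderiv k u differentiable (at t within {0..1})" if "k < 3" "t \<in> {0..1}" for k t
    proof (cases "k = 2")
      case True
      thus ?thesis using step(1)[OF that(2)] by (auto intro: differentiableI_vector)
    next
      case False
      thus ?thesis using cd2 that by (auto simp: cont_diff_def)
    qed
    moreover have "continuous_on {0..1} (\<lambda>t. - y t)"
      by (intro continuous_intros continuous_on_y)
    hence "continuous_on {0..1} (nderiv 3 u)"
      by (rule continuous_on_eq) (use step(2) J_one in auto)
    ultimately have "cont_diff 3 u" by (auto simp: cont_diff_def)
    thus ?thesis using True n step(2) J_one by (auto simp: caputo_differentiable_def caputo_def)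
  next
    case False
    hence "\<alpha> < 3" using \<alpha> by simp
    \<comment> \<open>\<open>\<beta>\<close> is the order of the fractional integral that gives the
      third derivative. The Caputo kernel has order \<open>1 - \<beta>\<close>, so the two orders
      add up to 1.\<close>
    define \<beta> where "\<beta> = \<alpha> - 2"
    have \<beta>: "0 < \<beta>" "\<beta> < 1" using \<alpha> \<open>\<alpha> < 3\<close> by (auto simp: \<beta>_def)
    have d2': "nderiv 2 u t = 0 - J (\<beta> + 1) t" if "t \<in> {0..1}" for t
      using d2[OF that] by (simp add: \<beta>_def)
    have G: "Gamma (1 - \<beta>) > 0" using \<beta> by simp
    obtain N where N: "negligible N" and
      "\<And>t. t \<in> {0..1} - N \<Longrightarrow> (J (\<beta> + 1) has_vector_derivative J \<beta> t) (at t within {0..1})"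
      using J_derivative_ae[OF \<beta>(1)] by blast
    hence d3: "nderiv 3 u t = - J \<beta> t" if "t \<in> {0..1} - N" for t
      using nderiv_step(2)[of 2 u 0 \<beta> t, OF d2'] that by auto
    have ac: "abs_continuous (nderiv 2 u)"
    proof (rule abs_continuous_of_integral_bound[OF J_integrable[OF \<beta>(1)] J_nonneg])
      fix s t :: real assume st: "0 \<le> s" "s \<le> t" "t \<le> 1"
      have "nderiv 2 u t - nderiv 2 u s = - (J (\<beta> + 1) t - J (\<beta> + 1) s)"
        using st by (simp add: d2')
      thus "\<bar>nderiv 2 u t - nderiv 2 u s\<bar> \<le> integral {s..t} (J \<beta>)"
        using J_increment[OF st \<beta>(1)] J_mono[OF st, of "\<beta> + 1"] \<beta> by simp
    qed
    have ker: "(caputo_kernel \<alpha> u t has_integral - (Gamma (1 - \<beta>) * y t)) {0..t}"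
      "((\<lambda>s. norm (caputo_kernel \<alpha> u t s)) has_integral Gamma (1 - \<beta>) * y t) {0..t}"
      if t: "t \<in> {0..1}" for t
    proof -
      have "((\<lambda>s. (t - s) powr (1 - \<beta> - 1) / Gamma (1 - \<beta>) * J \<beta> s) has_integral J (1 - \<beta> + \<beta>) t) {0..t}"
        by (rule J_frac_has_integral) (use \<beta> t in auto)
      hence "((\<lambda>s. Gamma (1 - \<beta>) * ((t - s) powr (- \<beta>) / Gamma (1 - \<beta>) * J \<beta> s)) has_integral
              Gamma (1 - \<beta>) * y t) {0..t}"
        using t by (intro has_integral_mult_right) (simp add: J_one)
      hence I: "((\<lambda>s. (t - s) powr (- \<beta>) * J \<beta> s) has_integral Gamma (1 - \<beta>) * y t) {0..t}"
        using G by (simp add: field_simps)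
      \<comment> \<open>Dividing by the power with exponent \<open>\<beta>\<close> and multiplying
        by the one with exponent \<open>- \<beta>\<close> agree even at \<open>s = t\<close>, where
        both give 0.\<close>
      have K: "caputo_kernel \<alpha> u t s = - ((t - s) powr (- \<beta>) * J \<beta> s)" if "s \<in> {0..t} - N" for s
      proof -
        have "\<alpha> + 1 - real 3 = \<beta>" by (simp add: \<beta>_def)
        thus ?thesis using d3[of s] that t by (simp add: caputo_kernel_def n powr_minus divide_inverse Let_def)
      qed
      show "(caputo_kernel \<alpha> u t has_integral - (Gamma (1 - \<beta>) * y t)) {0..t}"
        by (rule has_integral_spike[OF N K has_integral_neg[OF I]])
      \<comment> \<open>\<open>J \<beta>\<close> is nonnegative, so off \<open>N\<close> the kernel
        has constant sign and the same integral gives absolute convergence.\<close>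
      show "((\<lambda>s. norm (caputo_kernel \<alpha> u t s)) has_integral Gamma (1 - \<beta>) * y t) {0..t}"
        by (rule has_integral_spike[OF N _ I]) (use K J_nonneg in \<open>simp add: abs_mult\<close>)
    qed
    have "caputo_differentiable \<alpha> u"
      using False cd2 ac ker[THEN has_integral_integrable]
      by (auto simp: caputo_differentiable_def n absolutely_integrable_on_def)
    moreover have "caputo \<alpha> u t = - y t" if "t \<in> {0..1}" for t
    proof -
      have "caputo \<alpha> u t = 1 / Gamma (1 - \<beta>) * integral {0..t} (caputo_kernel \<alpha> u t)"
        using False by (simp add: caputo_def n Let_def \<beta>_def)
      thus ?thesis using G integral_unique[OF ker(1)[OF that]] by simp
    qed
    ultimately show ?thesis by blast
  qed
  thus "caputo_differentiable \<alpha> u" and "t \<in> {0..1} \<Longrightarrow> caputo \<alpha> u t = - y t" by auto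
qed

end

section \<open>The integral operator of the boundary value problem\<close>

lemma phi_nonneg_eq: "s \<ge> 0 \<Longrightarrow> phi p s = s powr (p - 1)"
  using powr_add[of s "p - 2" 1] by (cases "s = 0") (auto simp: phi_def)

lemma conjugate_exponents:
  fixes p q :: real
  assumes "p > 1" "1 / p + 1 / q = 1"
  shows "q > 1" "(p - 1) * (q - 1) = 1"
proof -
  have "q \<noteq> 0" using assms by auto
  hence "q + p = p * q" using assms by (simp add: field_simps)
  thus "(p - 1) * (q - 1) = 1" by (simp add: algebra_simps)
  hence "0 < (p - 1) * (q - 1)" by simp
  thus "q > 1" using assms by (simp add: zero_less_mult_iff)
qed

text \<open>On nonnegative numbers \<open>phi p\<close> is the power \<open>p - 1\<close>, inverted
  by the power \<open>q - 1\<close>. The version with a minus sign is for the Caputo derivative of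
  the solution, which is \<open>- y\<close>.\<close>

lemma phi_conjugate:
  assumes "p > 1" "1 / p + 1 / q = 1" "s \<ge> 0"
  shows "phi p (s powr (q - 1)) = s" "phi p (- (s powr (q - 1))) = - s"
    "phi p s powr (q - 1) = s"
proof -
  note pq = conjugate_exponents[OF assms(1,2)]
  show "phi p (s powr (q - 1)) = s" "phi p s powr (q - 1) = s"
    using pq \<open>s \<ge> 0\<close> by (simp_all add: phi_nonneg_eq powr_powr mult.commute)
  moreover have "phi p (- x) = - phi p x" for x by (simp add: phi_def)
  ultimately show "phi p (- (s powr (q - 1))) = - s" by simp
qed

lemma indefinite_integral_nonneg:
  fixes g :: "real \<Rightarrow> real"
  assumes g: "continuous_on {0..1} g" and pos: "\<And>t. t \<in> {0..1} \<Longrightarrow> g t \<ge> 0"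
  defines "G \<equiv> \<lambda>t. integral {0..t} g"
  shows "continuous_on {0..1} G"
    and "\<And>s t. 0 \<le> s \<Longrightarrow> s \<le> t \<Longrightarrow> t \<le> 1 \<Longrightarrow> G s \<le> G t"
    and "\<And>t. t \<in> {0..1} \<Longrightarrow> G t \<ge> 0"
    and "\<And>t. t \<in> {0<..<1} \<Longrightarrow> (G has_real_derivative g t) (at t)"
proof -
  have int: "g integrable_on {0..t}" if "t \<le> 1" for t
    by (rule integrable_continuous_real, rule continuous_on_subset[OF g]) (use that in auto)
  show "continuous_on {0..1} G" unfolding G_def by (rule indefinite_integral_continuous_1) (use int in auto)
  show "G s \<le> G t" if "0 \<le> s" "s \<le> t" "t \<le> 1" for s t
    unfolding G_def by (rule integral_subset_le) (use int pos that in auto)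
  show "G t \<ge> 0" if "t \<in> {0..1}" for t
    unfolding G_def by (rule integral_nonneg) (use int pos that in auto)
  show "(G has_real_derivative g t) (at t)" if t: "t \<in> {0<..<1}" for t
  proof -
    have "(G has_vector_derivative g t) (at t within {0..1})"
      unfolding G_def by (rule integral_has_vector_derivative[OF g]) (use t in auto)
    moreover have "at t within {0..1} = at t" by (rule at_within_interior) (use t in auto)
    ultimately show ?thesis by (simp add: has_real_derivative_iff_has_vector_derivative)
  qed
qed

text \<open>For \<open>r < 1\<close> the derivative of \<open>G powr r\<close> may blow up at the last zero of \<open>G\<close>, so \<open>G powr r\<close> is
  in general only absolutely continuous.\<close>

lemma nonneg_density_powr:
  fixes g :: "real \<Rightarrow> real"
  assumes g: "continuous_on {0..1} g" and pos: "\<And>t. t \<in> {0..1} \<Longrightarrow> g t \<ge> 0" and r: "r > 0"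
  obtains k where "nonneg_density k (\<lambda>t. integral {0..t} g powr r)"
proof -
  define G where "G t = integral {0..t} g" for t
  note G = indefinite_integral_nonneg[OF g pos, folded G_def]
  have G0: "G 0 = 0" by (simp add: G_def)
  \<comment> \<open>The zero set is compact and contains 0, so it has a largest element
    \<open>t0\<close>; by monotonicity \<open>G\<close> vanishes up to \<open>t0\<close> and is
    positive after it.\<close>
  define S where "S = {t \<in> {0..1}. G t = 0}"
  have "closed S"
    unfolding S_def by (rule continuous_closed_preimage_constant[OF G(1)]) auto
  moreover have "bounded S" by (rule bounded_subset[of "{0..1}"]) (auto simp: S_def)
  moreover have "0 \<in> S" using G0 by (simp add: S_def)
  ultimately obtain t0 where t0: "t0 \<in> S" "\<And>t. t \<in> S \<Longrightarrow> t \<le> t0"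
    using continuous_attains_sup[of S id] by (auto simp: compact_eq_bounded_closed)
  have before: "G t = 0" if "0 \<le> t" "t \<le> t0" for t
    using G(2)[of t t0] G(3)[of t] that t0 by (auto simp: S_def)
  have after: "G t > 0" if "t0 < t" "t \<le> 1" for t
    using G(3)[of t] t0(2)[of t] t0(1) that by (auto simp: S_def order_less_le)
  define k where "k t = indicator {t0<..<1} t *\<^sub>R (r * G t powr (r - 1) * g t)" for t
  have sub: "{t0<..<1} \<subseteq> {0..1}" using t0 by (auto simp: S_def)
  have "nonneg_density k (\<lambda>t. G t powr r)"
  proof
    have "\<forall>x\<in>{t0<..<1}. G x \<noteq> 0" using after by (metis greaterThanLessThan_iff less_le less_irrefl)
    hence "continuous_on {t0<..<1} (\<lambda>t. r * G t powr (r - 1) * g t)"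
      by (intro continuous_intros continuous_on_subset[OF G(1) sub] continuous_on_subset[OF g sub])
    thus "k \<in> borel_measurable borel"
      unfolding k_def by (intro borel_measurable_continuous_on_indicator) auto
    show "k t \<ge> 0" for t
      using pos[of t] r sub by (auto simp: k_def indicator_def)
    fix t :: real assume t: "t \<in> {0..1}"
    \<comment> \<open>The fundamental theorem tolerates the exceptional point \<open>t0\<close> and
      yields the integrability of \<open>k\<close>, although \<open>k\<close> may be unbounded near
      \<open>t0\<close>.\<close>
    have "(k has_integral G t powr r - G 0 powr r) {0..t}"
    proof (rule fundamental_theorem_of_calculus_interior_strong[of "{t0}"])
      have "continuous_on {0..1} (\<lambda>t. G t powr r)"
        using G(1,3) r by (intro continuous_on_powr') auto
      thus "continuous_on {0..t} (\<lambda>t. G t powr r)"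
        by (rule continuous_on_subset) (use t in auto)
      fix x assume x: "x \<in> {0<..<t} - {t0}"
      show "((\<lambda>t. G t powr r) has_vector_derivative k x) (at x)"
      proof (cases "x < t0")
        case True
        have "((\<lambda>t. 0) has_vector_derivative k x) (at x)" using True by (simp add: k_def)
        thus ?thesis
          by (rule has_vector_derivative_transform_within_open[of _ _ _ "{0<..<t0}"])
             (use True x before in auto)
      next
        case False
        hence "t0 < x" using x by auto
        moreover have "(G has_real_derivative g x) (at x)" using G(4) x t by auto
        ultimately have "((\<lambda>t. G t powr r) has_real_derivative r * G x powr (r - of_nat 1) * g x) (at x)"
          using after x t by (intro DERIV_fun_powr) auto
        thus ?thesis using \<open>t0 < x\<close> x t
          by (simp add: k_def has_real_derivative_iff_has_vector_derivative)
      qed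
    qed (use t in auto)
    thus "(k has_integral G t powr r) {0..t}" using G0 by simp
  qed
  thus ?thesis using that by (simp add: G_def)
qed

section \<open>The solution operator of the linear problem\<close>

definition frac_int :: "real \<Rightarrow> (real \<Rightarrow> real) \<Rightarrow> real \<Rightarrow> real" where
  "frac_int b y t = integral {0..t} (\<lambda>s. (t - s) powr (b - 1) / Gamma b * y s)"

text \<open>Inserting \<open>u = c - frac_int \<alpha> y\<close> into the condition
  \<open>u(1) + u'(1) = u'(\<eta>)\<close> determines \<open>c = u(0)\<close>; the integrals of
  orders \<open>\<alpha>\<close> and \<open>\<alpha> - 1\<close> at 1 combine into the one against
  \<open>Phi \<alpha>\<close>.\<close>

definition bvp_const :: "real \<Rightarrow> real \<Rightarrow> (real \<Rightarrow> real) \<Rightarrow> real" where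
  "bvp_const \<alpha> \<eta> y = integral {0..1} (\<lambda>s. Phi \<alpha> s * y s) - frac_int (\<alpha> - 1) y \<eta>"

definition green_op :: "real \<Rightarrow> real \<Rightarrow> (real \<Rightarrow> real) \<Rightarrow> real \<Rightarrow> real" where
  "green_op \<alpha> \<eta> y t = bvp_const \<alpha> \<eta> y - frac_int \<alpha> y t"

text \<open>Split \<open>\<alpha> - s\<close> as \<open>(1 - s) + (\<alpha> - 1)\<close> and use
  \<open>Gamma \<alpha> = (\<alpha> - 1) * Gamma (\<alpha> - 1)\<close>. The summands are the
  kernels of orders \<open>\<alpha>\<close> and \<open>\<alpha> - 1\<close> at 1; the exponent
  \<open>\<alpha> - 1 - 1\<close> keeps the shape of the latter.\<close>

lemma Phi_eq:
  assumes "\<alpha> > 2" "s \<le> 1"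
  shows "Phi \<alpha> s = (1 - s) powr (\<alpha> - 1) / Gamma \<alpha> + (1 - s) powr (\<alpha> - 1 - 1) / Gamma (\<alpha> - 1)"
proof -
  let ?X = "(1 - s) powr (\<alpha> - 2)" and ?G = "Gamma (\<alpha> - 1)"
  have G: "Gamma \<alpha> = (\<alpha> - 1) * ?G"
    using Gamma_plus1[of "\<alpha> - 1"] nonpos_Ints_nonpos[of "\<alpha> - 1"] assms by fastforce
  have X: "(1 - s) powr (\<alpha> - 1) = (1 - s) * ?X"
    using powr_add[of "1 - s" 1 "\<alpha> - 2"] assms by (cases "s = 1") auto
  have "Phi \<alpha> s = (1 - s) * ?X / Gamma \<alpha> + (\<alpha> - 1) * ?X / Gamma \<alpha>"
    unfolding Phi_def add_divide_distrib [symmetric] distrib_right [symmetric] by simp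
  also have "(\<alpha> - 1) * ?X / Gamma \<alpha> = ?X / ?G" using assms by (simp add: G)
  finally show ?thesis by (simp add: X)
qed

lemma continuous_on_Phi:
  assumes "\<alpha> > 2"
  shows "continuous_on {0..1} (Phi \<alpha>)"
proof -
  have "Gamma \<alpha> \<noteq> 0" using Gamma_real_pos[of \<alpha>] assms by linarith
  thus ?thesis unfolding Phi_def using assms
    by (intro continuous_on_divide continuous_on_mult continuous_on_diff continuous_on_powr'
        continuous_on_const continuous_on_id) auto
qed

lemma Phi_nonneg: "\<alpha> > 2 \<Longrightarrow> s \<le> 1 \<Longrightarrow> Phi \<alpha> s \<ge> 0"
  by (simp add: Phi_def)

lemma Phi_pos: "\<alpha> > 2 \<Longrightarrow> s < 1 \<Longrightarrow> Phi \<alpha> s > 0"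
  by (simp add: Phi_def)

context nonneg_density
begin

lemma frac_int_eq: "t \<in> {0..1} \<Longrightarrow> b > 0 \<Longrightarrow> frac_int b y t = J (b + 1) t"
  unfolding frac_int_def by (rule integral_unique) (rule J_integral_density)

lemma Phi_has_integral:
  assumes "\<alpha> > 2"
  shows "((\<lambda>s. Phi \<alpha> s * y s) has_integral J (\<alpha> + 1) 1 + J \<alpha> 1) {0..1}"
proof -
  have "((\<lambda>s. (1 - s) powr (\<alpha> - 1) / Gamma \<alpha> * y s + (1 - s) powr (\<alpha> - 1 - 1) / Gamma (\<alpha> - 1) * y s)
      has_integral J (\<alpha> + 1) 1 + J (\<alpha> - 1 + 1) 1) {0..1}"
    using assms by (intro has_integral_add J_integral_density) auto
  hence "((\<lambda>s. (1 - s) powr (\<alpha> - 1) / Gamma \<alpha> * y s + (1 - s) powr (\<alpha> - 1 - 1) / Gamma (\<alpha> - 1) * y s)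
      has_integral J (\<alpha> + 1) 1 + J \<alpha> 1) {0..1}" by simp
  thus ?thesis by (rule has_integral_eq[rotated]) (use assms in \<open>auto simp: Phi_eq distrib_right\<close>)
qed

lemma bvp_const_eq:
  assumes "\<alpha> > 2" "\<eta> \<in> {0..1}"
  shows "bvp_const \<alpha> \<eta> y = J (\<alpha> + 1) 1 + J \<alpha> 1 - J \<alpha> \<eta>"
  using Phi_has_integral[OF assms(1)] frac_int_eq[OF assms(2), of "\<alpha> - 1"] assms
  by (simp add: bvp_const_def integral_unique)

lemma green_op_eq:
  assumes "\<alpha> > 2" "t \<in> {0..1}"
  shows "green_op \<alpha> \<eta> y t = bvp_const \<alpha> \<eta> y - J (\<alpha> + 1) t"
  using frac_int_eq[OF assms(2), of \<alpha>] assms by (simp add: green_op_def)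

lemma green_op_0:
  assumes "\<alpha> > 2"
  shows "green_op \<alpha> \<eta> y 0 = bvp_const \<alpha> \<eta> y"
  using green_op_eq[of \<alpha> 0] J_zero[of "\<alpha> + 1"] assms by simp

text \<open>The integral of \<open>Phi \<alpha> s * y s\<close> is
  \<open>J (\<alpha> + 1) 1 + J \<alpha> 1\<close>, and the constant subtracts
  \<open>J \<alpha> \<eta>\<close> from it. Monotonicity of \<open>J \<alpha>\<close> gives the
  first bound and its scaling at \<open>\<eta>\<close> the third; the other two drop nonnegative
  terms.\<close>

lemma bvp_const_bounds:
  assumes "\<alpha> > 2" "\<eta> \<in> {0..1}"
  shows "bvp_const \<alpha> \<eta> y \<ge> J (\<alpha> + 1) 1"
    and "bvp_const \<alpha> \<eta> y \<le> integral {0..1} (\<lambda>s. Phi \<alpha> s * y s)"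
    and "bvp_const \<alpha> \<eta> y \<ge> (1 - \<eta> powr (\<alpha> - 1)) * integral {0..1} (\<lambda>s. Phi \<alpha> s * y s)"
    and "J \<alpha> 1 \<le> integral {0..1} (\<lambda>s. Phi \<alpha> s * y s)"
proof -
  have I: "integral {0..1} (\<lambda>s. Phi \<alpha> s * y s) = J (\<alpha> + 1) 1 + J \<alpha> 1"
    using Phi_has_integral[OF assms(1)] by (rule integral_unique)
  have "J \<alpha> \<eta> \<le> \<eta> powr (\<alpha> - 1) * J \<alpha> 1" using J_scale_le[OF assms(2)] assms by simp
  moreover have "0 \<le> \<eta> powr (\<alpha> - 1) * J (\<alpha> + 1) 1" using J_nonneg by simp
  ultimately show "bvp_const \<alpha> \<eta> y \<ge> (1 - \<eta> powr (\<alpha> - 1)) * integral {0..1} (\<lambda>s. Phi \<alpha> s * y s)"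
    unfolding bvp_const_eq[OF assms] I by (simp add: algebra_simps)
  show "bvp_const \<alpha> \<eta> y \<ge> J (\<alpha> + 1) 1"
    using J_mono[of \<eta> 1 \<alpha>] assms by (simp add: bvp_const_eq)
  show "bvp_const \<alpha> \<eta> y \<le> integral {0..1} (\<lambda>s. Phi \<alpha> s * y s)"
    unfolding bvp_const_eq[OF assms] I using J_nonneg by simp
  show "J \<alpha> 1 \<le> integral {0..1} (\<lambda>s. Phi \<alpha> s * y s)"
    unfolding I using J_nonneg by simp
qed

lemma green_op_decreasing:
  assumes "\<alpha> > 2" "0 \<le> s" "s \<le> t" "t \<le> 1"
  shows "green_op \<alpha> \<eta> y t \<le> green_op \<alpha> \<eta> y s"
  using J_mono[of s t "\<alpha> + 1"] assms by (simp add: green_op_eq)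

text \<open>Scaling bounds \<open>J (\<alpha> + 1) t\<close> by
  \<open>t powr \<alpha> * J (\<alpha> + 1) 1\<close>, and \<open>J (\<alpha> + 1) 1\<close> is at
  most the value at 0. Both positivity on (0,1) and the cone inequality rest on this.\<close>

lemma green_op_lower:
  assumes "\<alpha> > 2" "\<eta> \<in> {0..1}" "t \<in> {0..1}"
  shows "green_op \<alpha> \<eta> y t \<ge> (1 - t powr \<alpha>) * bvp_const \<alpha> \<eta> y"
proof -
  have "J (\<alpha> + 1) t \<le> t powr \<alpha> * J (\<alpha> + 1) 1" using J_scale_le[OF assms(3), of "\<alpha> + 1"] assms by simp
  also have "\<dots> \<le> t powr \<alpha> * bvp_const \<alpha> \<eta> y"
    using bvp_const_bounds(1)[OF assms(1,2)] by (intro mult_left_mono) auto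
  finally show ?thesis unfolding green_op_eq[OF assms(1,3)] by (simp add: algebra_simps)
qed

lemma green_op_Lipschitz:
  assumes "\<alpha> > 2" "s \<in> {0..1}" "t \<in> {0..1}"
  shows "\<bar>green_op \<alpha> \<eta> y s - green_op \<alpha> \<eta> y t\<bar> \<le> integral {0..1} (\<lambda>s. Phi \<alpha> s * y s) * \<bar>s - t\<bar>"
proof -
  have "\<bar>green_op \<alpha> \<eta> y s - green_op \<alpha> \<eta> y t\<bar> = \<bar>J (\<alpha> + 1) s - J (\<alpha> + 1) t\<bar>"
    using assms by (simp add: green_op_eq abs_minus_commute)
  also have "\<dots> \<le> J \<alpha> 1 * \<bar>s - t\<bar>" by (rule J_Lipschitz) (use assms in auto)
  \<comment> \<open>The bound on \<open>J \<alpha> 1\<close> does not depend on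
    \<open>\<eta>\<close>, so 0 is inserted as a placeholder.\<close>
  also have "\<dots> \<le> integral {0..1} (\<lambda>s. Phi \<alpha> s * y s) * \<bar>s - t\<bar>"
    using bvp_const_bounds(4)[of \<alpha> 0] assms by (intro mult_right_mono) auto
  finally show ?thesis .
qed

lemma green_op_solves:
  assumes \<alpha>: "2 < \<alpha>" "\<alpha> \<le> 3" and \<eta>: "\<eta> \<in> {0..1}"
    and u: "\<And>t. t \<in> {0..1} \<Longrightarrow> u t = green_op \<alpha> \<eta> y t"
  shows "caputo_differentiable \<alpha> u" and "t \<in> {0..1} \<Longrightarrow> caputo \<alpha> u t = - y t"
    and "nderiv 1 u 0 = 0" "nderiv 2 u 0 = 0" "u 1 + nderiv 1 u 1 = nderiv 1 u \<eta>"
proof -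
  have u': "u t = bvp_const \<alpha> \<eta> y - J (\<alpha> + 1) t" if "t \<in> {0..1}" for t
    using u[OF that] green_op_eq[OF \<alpha>(1) that] by simp
  show "caputo_differentiable \<alpha> u" by (rule caputo_fractional_integral(1)[OF \<alpha> u'])
  show "t \<in> {0..1} \<Longrightarrow> caputo \<alpha> u t = - y t" by (rule caputo_fractional_integral(2)[OF \<alpha> u'])
  have 1: "nderiv 1 u t = - J \<alpha> t" if "t \<in> {0..1}" for t
    by (rule nderiv_fractional_integral(1)[OF \<alpha>(1) u' that])
  have 2: "nderiv 2 u t = - J (\<alpha> - 1) t" if "t \<in> {0..1}" for t
    by (rule nderiv_fractional_integral(2)[OF \<alpha>(1) u' that])
  show "nderiv 1 u 0 = 0" "nderiv 2 u 0 = 0" using 1[of 0] 2[of 0] \<alpha> J_zero by auto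
  show "u 1 + nderiv 1 u 1 = nderiv 1 u \<eta>"
    using 1[of 1] 1[OF \<eta>] u'[of 1] bvp_const_eq[OF \<alpha>(1) \<eta>] by simp
qed

end

section \<open>Existence of a positive solution\<close>

text \<open>One estimate for three weights: the kernel of \<open>frac_int\<close>,
  \<open>Phi \<alpha>\<close>, and \<open>a\<close> in the nonlinear term.\<close>

lemma weighted_integral_diff:
  fixes k y z :: "real \<Rightarrow> real"
  assumes k: "continuous_on {0..t} k" "\<And>s. s \<in> {0..t} \<Longrightarrow> k s \<ge> 0"
    and yz: "continuous_on {0..t} y" "continuous_on {0..t} z" "\<And>s. s \<in> {0..t} \<Longrightarrow> \<bar>y s - z s\<bar> \<le> e"
  shows "\<bar>integral {0..t} (\<lambda>s. k s * y s) - integral {0..t} (\<lambda>s. k s * z s)\<bar> \<le> e * integral {0..t} k"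
proof -
  have i: "(\<lambda>s. k s * y s) integrable_on {0..t}" "(\<lambda>s. k s * z s) integrable_on {0..t}" "k integrable_on {0..t}"
    by (intro integrable_continuous_real continuous_intros k yz)+
  have "norm (integral {0..t} (\<lambda>s. k s * y s - k s * z s)) \<le> integral {0..t} (\<lambda>s. e * k s)"
  proof (rule integral_norm_bound_integral)
    show "(\<lambda>s. k s * y s - k s * z s) integrable_on {0..t}" using i by (intro integrable_diff)
    show "(\<lambda>s. e * k s) integrable_on {0..t}" using i(3) by (rule integrable_on_mult_right)
    fix s assume s: "s \<in> {0..t}"
    have "\<bar>k s * y s - k s * z s\<bar> = k s * \<bar>y s - z s\<bar>"
      using abs_mult[of "k s" "y s - z s"] k(2)[OF s] by (simp add: right_diff_distrib)
    also have "\<dots> \<le> k s * e" by (intro mult_left_mono yz(3) k(2) s)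
    finally show "norm (k s * y s - k s * z s) \<le> e * k s" by (simp add: mult.commute)
  qed
  thus ?thesis using i by (simp add: integral_diff)
qed

lemma frac_int_diff:
  fixes y z :: "real \<Rightarrow> real"
  assumes b: "b > 1" and t: "t \<in> {0..1}"
    and yz: "continuous_on {0..1} y" "continuous_on {0..1} z" "\<And>s. s \<in> {0..1} \<Longrightarrow> \<bar>y s - z s\<bar> \<le> e"
  shows "\<bar>frac_int b y t - frac_int b z t\<bar> \<le> e / Gamma b"
proof -
  have G: "Gamma b > 0" using b by simp
  hence G0: "Gamma b \<noteq> 0" by simp
  have e: "e \<ge> 0" using yz(3)[of 0] by simp
  have sub: "{0..t} \<subseteq> {0..1}" using t by auto
  let ?k = "\<lambda>s. (t - s) powr (b - 1) / Gamma b"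
  have k: "continuous_on {0..t} ?k"
    by (intro continuous_on_divide continuous_on_powr' continuous_on_diff continuous_on_const continuous_on_id)
       (use b in \<open>auto simp: G0\<close>)
  have "\<bar>frac_int b y t - frac_int b z t\<bar> \<le> e * integral {0..t} ?k"
    unfolding frac_int_def
    by (intro weighted_integral_diff k continuous_on_subset[OF yz(1) sub] continuous_on_subset[OF yz(2) sub])
       (use G sub yz(3) in auto)
  also have "integral {0..t} ?k \<le> integral {0..t} (\<lambda>_. 1 / Gamma b)"
    by (rule integral_le) (use k b t powr_div_Gamma_le in \<open>auto intro!: integrable_continuous_real\<close>)
  also have "\<dots> \<le> 1 / Gamma b" using t G by (simp add: divide_right_mono)
  finally show ?thesis using e by (simp add: mult_left_mono)
qed

lemma green_op_diff:
  fixes y z :: "real \<Rightarrow> real"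
  assumes \<alpha>: "\<alpha> > 2" and \<eta>: "\<eta> \<in> {0..1}" and t: "t \<in> {0..1}"
    and yz: "continuous_on {0..1} y" "continuous_on {0..1} z" "\<And>s. s \<in> {0..1} \<Longrightarrow> \<bar>y s - z s\<bar> \<le> e"
  shows "\<bar>green_op \<alpha> \<eta> y t - green_op \<alpha> \<eta> z t\<bar> \<le>
    e * (integral {0..1} (Phi \<alpha>) + 1 / Gamma (\<alpha> - 1) + 1 / Gamma \<alpha>)"
proof -
  have "\<bar>integral {0..1} (\<lambda>s. Phi \<alpha> s * y s) - integral {0..1} (\<lambda>s. Phi \<alpha> s * z s)\<bar>
      \<le> e * integral {0..1} (Phi \<alpha>)"
    by (rule weighted_integral_diff) (use yz \<alpha> continuous_on_Phi Phi_nonneg in auto)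
  moreover have "\<bar>frac_int (\<alpha> - 1) y \<eta> - frac_int (\<alpha> - 1) z \<eta>\<bar> \<le> e / Gamma (\<alpha> - 1)"
    by (rule frac_int_diff) (use \<alpha> \<eta> yz in auto)
  moreover have "\<bar>frac_int \<alpha> y t - frac_int \<alpha> z t\<bar> \<le> e / Gamma \<alpha>"
    by (rule frac_int_diff) (use \<alpha> t yz in auto)
  ultimately show ?thesis by (simp add: green_op_def bvp_const_def distrib_left)
qed

section \<open>The hypotheses on the nonlinearity and the bounds they imply\<close>

locale p_laplacian_bvp =
  fixes p q \<alpha> \<eta> \<rho> \<rho>\<^sub>1 \<rho>\<^sub>2 M\<^sub>1 M\<^sub>2 :: real
    and a :: "real \<Rightarrow> real" and f :: "real \<Rightarrow> real \<Rightarrow> real"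
  assumes p: "p > 1" and pq: "1 / p + 1 / q = 1"
    and \<alpha>: "2 < \<alpha>" "\<alpha> \<le> 3" and \<eta>: "\<eta> \<in> {0<..<1}" and \<rho>: "\<rho> \<in> {0<..<1}"
    and f_cont: "continuous_on ({0..1} \<times> {0..}) (\<lambda>(t, u). f t u)"
    and f_nonneg: "\<And>t u. t \<in> {0..1} \<Longrightarrow> u \<ge> 0 \<Longrightarrow> f t u \<ge> 0"
    and a_cont: "continuous_on {0..1} a"
    and a_nonneg: "\<And>t. t \<in> {0..1} \<Longrightarrow> a t \<ge> 0"
    and a_nz: "\<And>c d. 0 \<le> c \<Longrightarrow> c < d \<Longrightarrow> d \<le> 1 \<Longrightarrow> \<exists>t\<in>{c..d}. a t \<noteq> 0"
    and \<rho>\<^sub>1: "\<rho>\<^sub>1 > 0" and \<rho>12: "\<rho>\<^sub>1 < \<rho>\<^sub>2"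
    and M\<^sub>1: "M\<^sub>1 \<in> {0<..Lambda1 q \<alpha> a}" and M\<^sub>2: "M\<^sub>2 \<in> {Lambda2 q \<alpha> \<eta> \<rho> a..}"
    and f_upper: "\<And>t u. u \<in> {0..\<rho>\<^sub>2} \<Longrightarrow> t \<in> {0..1} \<Longrightarrow> f t u \<le> phi p (M\<^sub>1 * \<rho>\<^sub>2)"
    and f_lower: "\<And>t u. u \<in> {cone_const \<alpha> \<eta> \<rho> * \<rho>\<^sub>1..\<rho>\<^sub>1} \<Longrightarrow> t \<in> {0..\<rho>} \<Longrightarrow> f t u \<ge> phi p (M\<^sub>2 * \<rho>\<^sub>1)"
begin

abbreviation "\<gamma> \<equiv> cone_const \<alpha> \<eta> \<rho>"

definition A :: "real \<Rightarrow> real" where "A t = integral {0..t} a"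

definition B :: "(real \<Rightarrow> real) set" where
  "B = {u. continuous_on {0..1} u \<and> u ` {0..1} \<subseteq> {0..\<rho>\<^sub>2}}"

definition G :: "(real \<Rightarrow> real) \<Rightarrow> real \<Rightarrow> real" where
  "G v t = integral {0..t} (\<lambda>s. a s * f s (v s))"

definition y :: "(real \<Rightarrow> real) \<Rightarrow> real \<Rightarrow> real" where
  "y v t = G v t powr (q - 1)"

lemma \<rho>\<^sub>2: "\<rho>\<^sub>2 > 0" using \<rho>\<^sub>1 \<rho>12 by simp

lemma q: "q > 1" using conjugate_exponents[OF p pq] by simp

text \<open>The middle two bounds drop one factor of \<open>\<gamma>\<close> and raise the exponent
  in the other by one, which lowers a power with base below 1. The second is strict because
  \<open>\<rho> powr (\<alpha> - 1)\<close> is positive, and this strictness becomes that of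
  \<open>\<rho>\<^sub>1 < sup_norm u\<close>.\<close>

lemma gamma_bounds:
  shows "\<gamma> > 0" "\<gamma> < 1 - \<eta> powr (\<alpha> - 1)" "\<gamma> \<le> 1 - \<rho> powr \<alpha>" "\<gamma> \<le> 1"
proof -
  let ?x = "\<eta> powr (\<alpha> - 2)" and ?z = "\<rho> powr (\<alpha> - 1)"
  have x: "0 < ?x" "?x < 1" and z: "0 < ?z" "?z < 1"
    using \<eta> \<rho> \<alpha> powr_less_mono2[of "\<alpha> - 2" \<eta> 1] powr_less_mono2[of "\<alpha> - 1" \<rho> 1] by auto
  have le: "\<eta> powr (\<alpha> - 1) \<le> ?x" "\<rho> powr \<alpha> \<le> ?z" using \<eta> \<rho> by (auto intro!: powr_mono')
  have g: "\<gamma> = (1 - ?x) * (1 - ?z)" by (simp add: cone_const_def)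
  show "\<gamma> > 0" using x z by (simp add: g)
  have "(1 - ?x) * (1 - ?z) < (1 - ?x) * 1" using x z by (intro mult_strict_left_mono) auto
  thus "\<gamma> < 1 - \<eta> powr (\<alpha> - 1)" using le by (simp add: g)
  have "(1 - ?x) * (1 - ?z) \<le> 1 * (1 - ?z)" using x z by (intro mult_right_mono) auto
  also have "\<dots> \<le> 1 - \<rho> powr \<alpha>" using le by simp
  finally show "\<gamma> \<le> 1 - \<rho> powr \<alpha>" by (simp add: g)
  thus "\<gamma> \<le> 1" by (rule order_trans) simp
qed

lemma A_props: "continuous_on {0..1} A" "0 \<le> s \<Longrightarrow> s \<le> t \<Longrightarrow> t \<le> 1 \<Longrightarrow> A s \<le> A t"
  "t \<in> {0..1} \<Longrightarrow> A t \<ge> 0" "t \<in> {0<..1} \<Longrightarrow> A t > 0"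
proof -
  note A = indefinite_integral_nonneg[OF a_cont a_nonneg, folded A_def]
  show "continuous_on {0..1} A" "0 \<le> s \<Longrightarrow> s \<le> t \<Longrightarrow> t \<le> 1 \<Longrightarrow> A s \<le> A t"
    "t \<in> {0..1} \<Longrightarrow> A t \<ge> 0" using A by auto
  show "A t > 0" if t: "t \<in> {0<..1}"
  proof -
    have "continuous_on {0..t} a" by (rule continuous_on_subset[OF a_cont]) (use t in auto)
    hence "A t \<noteq> 0" unfolding A_def
      by (subst integral_eq_0_iff) (use t a_nonneg a_nz[of 0 t] in auto)
    thus ?thesis using A(3)[of t] t by force
  qed
qed

lemma phi_A: "t \<in> {0..1} \<Longrightarrow> phi q (integral {0..t} a) = A t powr (q - 1)"
  using A_props(3)[of t] by (simp add: A_def phi_nonneg_eq)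

lemma integral_Phi_pos: "integral {0..1} (Phi \<alpha>) > 0"
proof -
  have "integral {0..1} (Phi \<alpha>) \<noteq> 0"
    by (subst integral_eq_0_iff)
       (use continuous_on_Phi \<alpha> Phi_nonneg Phi_pos[of \<alpha> 0] in \<open>auto simp: less_le\<close>)
  moreover have "integral {0..1} (Phi \<alpha>) \<ge> 0"
    by (rule integral_nonneg) (use continuous_on_Phi \<alpha> Phi_nonneg in \<open>auto intro: integrable_continuous_real\<close>)
  ultimately show ?thesis by simp
qed

lemma M\<^sub>1_le: "M\<^sub>1 * A 1 powr (q - 1) * integral {0..1} (Phi \<alpha>) \<le> 1"
proof -
  let ?P = "A 1 powr (q - 1) * integral {0..1} (Phi \<alpha>)"
  have P: "?P > 0" using A_props(4)[of 1] integral_Phi_pos by simp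
  have "M\<^sub>1 \<le> inverse ?P" using M\<^sub>1 phi_A[of 1] by (simp add: Lambda1_def)
  hence "M\<^sub>1 * ?P \<le> inverse ?P * ?P" using P by (intro mult_right_mono) auto
  also have "inverse ?P * ?P = 1" by (rule left_inverse[OF less_imp_neq[OF P, symmetric]])
  finally show ?thesis by (simp only: mult.assoc)
qed

lemma Phi_A_continuous: "continuous_on {0..1} (\<lambda>s. Phi \<alpha> s * A s powr (q - 1))"
  using continuous_on_Phi[OF \<alpha>(1)] A_props(1,3) q by (intro continuous_on_mult continuous_on_powr') auto

lemma M\<^sub>2_ge:
  shows "M\<^sub>2 > 0" "1 \<le> \<gamma> * (M\<^sub>2 * integral {0..\<rho>} (\<lambda>s. Phi \<alpha> s * A s powr (q - 1)))"
proof -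
  let ?g = "\<lambda>s. Phi \<alpha> s * A s powr (q - 1)"
  let ?I = "integral {0..\<rho>} ?g"
  have c: "continuous_on {0..\<rho>} ?g" by (rule continuous_on_subset[OF Phi_A_continuous]) (use \<rho> in auto)
  have nn: "?g s \<ge> 0" if "s \<in> {0..\<rho>}" for s using Phi_nonneg[of \<alpha> s] \<alpha> that \<rho> by auto
  \<comment> \<open>The integrand is positive at \<open>\<rho>\<close>, so \<open>Lambda2\<close> is
    a genuine reciprocal and not the default \<open>inverse 0 = 0\<close>.\<close>
  have "?I \<noteq> 0"
  proof (subst integral_eq_0_iff[OF c])
    have "?g \<rho> \<noteq> 0" using Phi_pos[OF \<alpha>(1), of \<rho>] A_props(4)[of \<rho>] \<rho> by auto
    thus "\<not> (\<forall>x\<in>{0..\<rho>}. ?g x = 0)" using \<rho> by force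
  qed (use \<rho> nn in auto)
  moreover have "?I \<ge> 0" by (rule integral_nonneg) (use c nn in \<open>auto intro: integrable_continuous_real\<close>)
  ultimately have I: "\<gamma> * ?I > 0" using gamma_bounds(1) by simp
  have "integral {0..\<rho>} (\<lambda>s. Phi \<alpha> s * phi q (integral {0..s} a)) = ?I"
    by (rule integral_cong) (use phi_A \<rho> in auto)
  hence M: "M\<^sub>2 \<ge> inverse (\<gamma> * ?I)" using M\<^sub>2 by (simp add: Lambda2_def)
  thus "M\<^sub>2 > 0" using I by (meson order_less_le_trans positive_imp_inverse_positive)
  have "inverse (\<gamma> * ?I) * (\<gamma> * ?I) \<le> M\<^sub>2 * (\<gamma> * ?I)" using M I by (intro mult_right_mono) auto
  moreover have "inverse (\<gamma> * ?I) * (\<gamma> * ?I) = 1" by (rule left_inverse[OF less_imp_neq[OF I, symmetric]])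
  ultimately show "1 \<le> \<gamma> * (M\<^sub>2 * ?I)" by (simp only: mult_ac)
qed

lemma v_range: "v \<in> B \<Longrightarrow> s \<in> {0..1} \<Longrightarrow> v s \<in> {0..\<rho>\<^sub>2}"
  unfolding B_def by blast

lemma f_comp_cont:
  assumes "v \<in> B"
  shows "continuous_on {0..1} (\<lambda>s. f s (v s))"
proof -
  have "continuous_on {0..1} (\<lambda>s. (s, v s))"
    using assms by (auto simp: B_def intro!: continuous_intros)
  moreover have "(\<lambda>s. (s, v s)) ` {0..1} \<subseteq> {0..1} \<times> {0..}" using v_range[OF assms] by auto
  ultimately show ?thesis using continuous_on_compose2[OF f_cont, of "{0..1}" "\<lambda>s. (s, v s)"] by simp
qed

lemma integrand:
  assumes "v \<in> B"
  shows "continuous_on {0..1} (\<lambda>s. a s * f s (v s))"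
    "\<And>s. s \<in> {0..1} \<Longrightarrow> a s * f s (v s) \<ge> 0"
  using f_comp_cont[OF assms] a_cont v_range[OF assms] a_nonneg f_nonneg
  by (auto intro!: continuous_intros mult_nonneg_nonneg)

lemma G_props:
  assumes "v \<in> B"
  shows "continuous_on {0..1} (G v)"
    and "0 \<le> s \<Longrightarrow> s \<le> t \<Longrightarrow> t \<le> 1 \<Longrightarrow> G v s \<le> G v t"
    and "t \<in> {0..1} \<Longrightarrow> G v t \<ge> 0"
    and "t \<in> {0<..<1} \<Longrightarrow> (G v has_real_derivative a t * f t (v t)) (at t)"
  using indefinite_integral_nonneg[OF integrand[OF assms], folded G_def] by blast+

lemma density:
  assumes "v \<in> B"
  obtains k where "nonneg_density k (y v)"
  using nonneg_density_powr[OF integrand[OF assms], of "q - 1"] q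
  by (auto simp: y_def[abs_def] G_def)

lemma y_cont: "v \<in> B \<Longrightarrow> continuous_on {0..1} (y v)"
  by (rule density) (auto intro: nonneg_density.continuous_on_y)

lemma G_upper:
  assumes v: "v \<in> B" and t: "t \<in> {0..1}"
  shows "G v t \<le> phi p (M\<^sub>1 * \<rho>\<^sub>2) * A t"
proof -
  have sub: "{0..t} \<subseteq> {0..1}" using t by auto
  have "G v t \<le> integral {0..t} (\<lambda>s. phi p (M\<^sub>1 * \<rho>\<^sub>2) * a s)"
    unfolding G_def
  proof (rule integral_le)
    show "(\<lambda>s. a s * f s (v s)) integrable_on {0..t}"
      by (rule integrable_continuous_real) (rule continuous_on_subset[OF integrand(1)[OF v] sub])
    show "(\<lambda>s. phi p (M\<^sub>1 * \<rho>\<^sub>2) * a s) integrable_on {0..t}"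
      by (intro integrable_continuous_real continuous_intros continuous_on_subset[OF a_cont sub])
    show "a s * f s (v s) \<le> phi p (M\<^sub>1 * \<rho>\<^sub>2) * a s" if "s \<in> {0..t}" for s
      using f_upper[OF v_range[OF v], of s s] a_nonneg[of s] that sub
      by (subst mult.commute) (auto intro!: mult_right_mono)
  qed
  thus ?thesis by (simp add: A_def)
qed

lemma y_upper:
  assumes v: "v \<in> B" and t: "t \<in> {0..1}"
  shows "y v t \<le> M\<^sub>1 * \<rho>\<^sub>2 * A t powr (q - 1)"
proof -
  have "y v t \<le> (phi p (M\<^sub>1 * \<rho>\<^sub>2) * A t) powr (q - 1)"
    unfolding y_def using G_upper[OF v t] G_props(3)[OF v t] q by (intro powr_mono2) auto
  also have "\<dots> = M\<^sub>1 * \<rho>\<^sub>2 * A t powr (q - 1)"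
    using phi_conjugate(3)[OF p pq, of "M\<^sub>1 * \<rho>\<^sub>2"] M\<^sub>1 \<rho>\<^sub>2 by (simp add: powr_mult)
  finally show ?thesis .
qed

lemma y_lower:
  assumes v: "v \<in> B" and low: "\<And>s. s \<in> {0..\<rho>} \<Longrightarrow> v s \<in> {\<gamma> * \<rho>\<^sub>1..\<rho>\<^sub>1}" and t: "t \<in> {0..\<rho>}"
  shows "y v t \<ge> M\<^sub>2 * \<rho>\<^sub>1 * A t powr (q - 1)"
proof -
  have sub: "{0..t} \<subseteq> {0..1}" using t \<rho> by auto
  have M: "M\<^sub>2 * \<rho>\<^sub>1 \<ge> 0" using M\<^sub>2_ge(1) \<rho>\<^sub>1 by simp
  have "integral {0..t} (\<lambda>s. phi p (M\<^sub>2 * \<rho>\<^sub>1) * a s) \<le> G v t"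
    unfolding G_def
  proof (rule integral_le)
    show "(\<lambda>s. a s * f s (v s)) integrable_on {0..t}"
      by (rule integrable_continuous_real) (rule continuous_on_subset[OF integrand(1)[OF v] sub])
    show "(\<lambda>s. phi p (M\<^sub>2 * \<rho>\<^sub>1) * a s) integrable_on {0..t}"
      by (intro integrable_continuous_real continuous_intros continuous_on_subset[OF a_cont sub])
    show "phi p (M\<^sub>2 * \<rho>\<^sub>1) * a s \<le> a s * f s (v s)" if "s \<in> {0..t}" for s
      using f_lower[OF low, of s s] a_nonneg[of s] that t \<rho>
      by (subst mult.commute) (auto intro!: mult_left_mono)
  qed
  hence "phi p (M\<^sub>2 * \<rho>\<^sub>1) * A t \<le> G v t" by (simp add: A_def)
  moreover have "phi p (M\<^sub>2 * \<rho>\<^sub>1) * A t \<ge> 0"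
    using M A_props(3)[of t] t \<rho> by (simp add: phi_nonneg_eq)
  ultimately have "(phi p (M\<^sub>2 * \<rho>\<^sub>1) * A t) powr (q - 1) \<le> y v t"
    unfolding y_def using q by (intro powr_mono2) auto
  thus ?thesis using phi_conjugate(3)[OF p pq M] by (simp add: powr_mult)
qed

text \<open>Strictness comes from the left end point: \<open>y v\<close> vanishes at 0 while the
  uniform bound \<open>Y\<close> is positive, so the continuous nonnegative function
  \<open>Phi \<alpha> s * (Y - y v s)\<close> is not identically 0.\<close>

lemma integral_Phi_y_less:
  assumes v: "v \<in> B"
  shows "integral {0..1} (\<lambda>s. Phi \<alpha> s * y v s) < \<rho>\<^sub>2"
proof -
  define Y where "Y = M\<^sub>1 * \<rho>\<^sub>2 * A 1 powr (q - 1)"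
  have Y: "Y > 0" using M\<^sub>1 \<rho>\<^sub>2 A_props(4)[of 1] by (simp add: Y_def)
  have yY: "y v s \<le> Y" if "s \<in> {0..1}" for s
  proof -
    have "A s powr (q - 1) \<le> A 1 powr (q - 1)"
      using A_props(2)[of s 1] A_props(3)[of s] that q by (intro powr_mono2) auto
    hence "M\<^sub>1 * \<rho>\<^sub>2 * A s powr (q - 1) \<le> Y" unfolding Y_def using M\<^sub>1 \<rho>\<^sub>2 by (intro mult_left_mono) auto
    thus ?thesis using y_upper[OF v that] by simp
  qed
  have P: "continuous_on {0..1} (Phi \<alpha>)" by (rule continuous_on_Phi[OF \<alpha>(1)])
  have c: "continuous_on {0..1} (\<lambda>s. Phi \<alpha> s * (Y - y v s))"
    by (intro continuous_intros P y_cont[OF v])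
  have nn: "Phi \<alpha> s * (Y - y v s) \<ge> 0" if "s \<in> {0..1}" for s
    using Phi_nonneg[OF \<alpha>(1), of s] yY[OF that] that by auto
  have y0: "y v 0 = 0" by (simp add: y_def G_def)
  have "integral {0..1} (\<lambda>s. Phi \<alpha> s * (Y - y v s)) \<noteq> 0"
  proof (subst integral_eq_0_iff[OF c])
    have "Phi \<alpha> 0 * (Y - y v 0) \<noteq> 0" using Phi_pos[OF \<alpha>(1), of 0] Y y0 by simp
    thus "\<not> (\<forall>x\<in>{0..1}. Phi \<alpha> x * (Y - y v x) = 0)" by force
  qed (use nn in auto)
  moreover have "integral {0..1} (\<lambda>s. Phi \<alpha> s * (Y - y v s)) \<ge> 0"
    by (rule integral_nonneg[OF integrable_continuous_real[OF c] nn])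
  moreover have "integral {0..1} (\<lambda>s. Phi \<alpha> s * (Y - y v s)) =
      integral {0..1} (\<lambda>s. Phi \<alpha> s * Y) - integral {0..1} (\<lambda>s. Phi \<alpha> s * y v s)"
    unfolding right_diff_distrib
    by (intro integral_diff integrable_continuous_real continuous_intros P y_cont[OF v])
  ultimately have "integral {0..1} (\<lambda>s. Phi \<alpha> s * y v s) < integral {0..1} (Phi \<alpha>) * Y" by simp
  also have "\<dots> = (M\<^sub>1 * A 1 powr (q - 1) * integral {0..1} (Phi \<alpha>)) * \<rho>\<^sub>2" by (simp add: Y_def)
  also have "\<dots> \<le> 1 * \<rho>\<^sub>2" using M\<^sub>1_le \<rho>\<^sub>2 by (intro mult_right_mono) auto
  finally show ?thesis by simp
qed

text \<open>Condition (ii) on \<open>{0..\<rho>}\<close> and the choice of \<open>Lambda2\<close>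
  give \<open>\<rho>\<^sub>1 \<le> \<gamma> * ?I\<close>. The gap between \<open>\<gamma>\<close>
  and \<open>1 - \<eta> powr (\<alpha> - 1)\<close> then makes the inequality strict.\<close>

lemma bvp_const_greater:
  assumes v: "v \<in> B" and low: "\<And>s. s \<in> {0..\<rho>} \<Longrightarrow> v s \<in> {\<gamma> * \<rho>\<^sub>1..\<rho>\<^sub>1}"
  shows "bvp_const \<alpha> \<eta> (y v) > \<rho>\<^sub>1"
proof -
  obtain k where "nonneg_density k (y v)" using density[OF v] .
  then interpret nonneg_density k "y v" .
  let ?I = "integral {0..1} (\<lambda>s. Phi \<alpha> s * y v s)" and ?g = "\<lambda>s. Phi \<alpha> s * A s powr (q - 1)"
  have sub: "{0..\<rho>} \<subseteq> {0..1}" using \<rho> by auto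
  have c: "continuous_on {0..1} (\<lambda>s. Phi \<alpha> s * y v s)"
    by (intro continuous_intros continuous_on_Phi \<alpha> y_cont[OF v])
  have "\<rho>\<^sub>1 * 1 \<le> \<rho>\<^sub>1 * (\<gamma> * (M\<^sub>2 * integral {0..\<rho>} ?g))"
    using M\<^sub>2_ge(2) \<rho>\<^sub>1 by (intro mult_left_mono) auto
  hence "\<rho>\<^sub>1 \<le> \<gamma> * (M\<^sub>2 * \<rho>\<^sub>1 * integral {0..\<rho>} ?g)" by (simp add: mult_ac)
  also have "M\<^sub>2 * \<rho>\<^sub>1 * integral {0..\<rho>} ?g = integral {0..\<rho>} (\<lambda>s. M\<^sub>2 * \<rho>\<^sub>1 * ?g s)" by simp
  also have "\<gamma> * \<dots> \<le> \<gamma> * ?I"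
  proof (intro mult_left_mono)
    have "integral {0..\<rho>} (\<lambda>s. M\<^sub>2 * \<rho>\<^sub>1 * ?g s) \<le> integral {0..\<rho>} (\<lambda>s. Phi \<alpha> s * y v s)"
    proof (rule integral_le)
      show "(\<lambda>s. M\<^sub>2 * \<rho>\<^sub>1 * ?g s) integrable_on {0..\<rho>}"
        by (intro integrable_on_mult_right integrable_continuous_real continuous_on_subset[OF Phi_A_continuous sub])
      show "(\<lambda>s. Phi \<alpha> s * y v s) integrable_on {0..\<rho>}"
        by (intro integrable_continuous_real continuous_on_subset[OF c sub])
      show "M\<^sub>2 * \<rho>\<^sub>1 * ?g s \<le> Phi \<alpha> s * y v s" if "s \<in> {0..\<rho>}" for s
        using mult_left_mono[OF y_lower[OF v low that] Phi_nonneg[OF \<alpha>(1), of s]] that \<rho>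
        by (simp add: mult_ac)
    qed
    also have "\<dots> \<le> ?I"
      by (rule integral_subset_le[OF sub])
         (use c continuous_on_subset[OF c sub] Phi_nonneg[OF \<alpha>(1)] y_nonneg in
           \<open>auto intro!: integrable_continuous_real\<close>)
    finally show "integral {0..\<rho>} (\<lambda>s. M\<^sub>2 * \<rho>\<^sub>1 * ?g s) \<le> ?I" .
  qed (use gamma_bounds(1) in auto)
  finally have le: "\<rho>\<^sub>1 \<le> \<gamma> * ?I" .
  \<comment> \<open>Positivity of the integral is what allows the strict inequality for
    \<open>\<gamma>\<close> to be multiplied by it.\<close>
  hence "?I > 0" using \<rho>\<^sub>1 gamma_bounds(1) by (smt (verit) mult_nonneg_nonpos)
  hence "\<gamma> * ?I < (1 - \<eta> powr (\<alpha> - 1)) * ?I" using gamma_bounds(2) by (rule mult_strict_right_mono[rotated])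
  also have "\<dots> \<le> bvp_const \<alpha> \<eta> (y v)" using bvp_const_bounds(3)[OF \<alpha>(1), of \<eta>] \<eta> by simp
  finally show ?thesis using le by simp
qed

text \<open>Compactness supplies moduli for \<open>f\<close> on
  \<open>{0..1} \<times> {0..\<rho>\<^sub>2}\<close> and for the power \<open>q - 1\<close> on the
  common range of all \<open>G v\<close>; for \<open>q < 2\<close> that power is not Lipschitz at
  0.\<close>

lemma y_uniformly_continuous:
  assumes "e > 0"
  obtains d where "d > 0" "\<And>v w t. v \<in> B \<Longrightarrow> w \<in> B \<Longrightarrow> (\<And>s. s \<in> {0..1} \<Longrightarrow> \<bar>v s - w s\<bar> < d) \<Longrightarrow>
    t \<in> {0..1} \<Longrightarrow> \<bar>y v t - y w t\<bar> < e"
proof -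
  define Gm where "Gm = phi p (M\<^sub>1 * \<rho>\<^sub>2) * A 1"
  have G_range: "G v t \<in> {0..Gm}" if "v \<in> B" "t \<in> {0..1}" for v t
  proof -
    have "G v t \<le> G v 1" using G_props(2)[OF that(1), of t 1] that by auto
    thus ?thesis using G_upper[OF that(1), of 1] G_props(3)[OF that] by (auto simp: Gm_def)
  qed
  have "uniformly_continuous_on {0..Gm} (\<lambda>x. x powr (q - 1))"
    using q by (intro compact_uniformly_continuous continuous_on_powr') (auto intro!: continuous_intros)
  then obtain d1 where d1: "d1 > 0" "\<And>x x'. x \<in> {0..Gm} \<Longrightarrow> x' \<in> {0..Gm} \<Longrightarrow> \<bar>x' - x\<bar> < d1 \<Longrightarrow>
      \<bar>x' powr (q - 1) - x powr (q - 1)\<bar> < e"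
    unfolding uniformly_continuous_on_def dist_real_def using \<open>e > 0\<close> by meson
  have A1: "A 1 > 0" using A_props(4)[of 1] by simp
  have "uniformly_continuous_on ({0..1} \<times> {0..\<rho>\<^sub>2}) (\<lambda>(t, u). f t u)"
    by (intro compact_uniformly_continuous continuous_on_subset[OF f_cont]) (auto intro: compact_Times)
  \<comment> \<open>The weight \<open>a\<close> has total mass \<open>A 1\<close>, and the factor 2
    leaves room for a strict inequality.\<close>
  moreover have "d1 / (2 * A 1) > 0" using d1 A1 by simp
  ultimately obtain d where d: "d > 0" and "\<forall>x\<in>{0..1} \<times> {0..\<rho>\<^sub>2}. \<forall>x'\<in>{0..1} \<times> {0..\<rho>\<^sub>2}. dist x' x < d \<longrightarrow>
      dist (case x' of (t, u) \<Rightarrow> f t u) (case x of (t, u) \<Rightarrow> f t u) < d1 / (2 * A 1)"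
    unfolding uniformly_continuous_on_def by meson
  hence fd: "\<bar>f s x' - f s x\<bar> < d1 / (2 * A 1)"
    if "s \<in> {0..1}" "x \<in> {0..\<rho>\<^sub>2}" "x' \<in> {0..\<rho>\<^sub>2}" "\<bar>x' - x\<bar> < d" for s x x'
    using that by (fastforce simp: dist_Pair_Pair dist_real_def)
  have "\<bar>y v t - y w t\<bar> < e"
    if v: "v \<in> B" and w: "w \<in> B" and vw: "\<And>s. s \<in> {0..1} \<Longrightarrow> \<bar>v s - w s\<bar> < d" and t: "t \<in> {0..1}" for v w t
  proof -
    have sub: "{0..t} \<subseteq> {0..1}" using t by auto
    have "\<bar>G v t - G w t\<bar> \<le> d1 / (2 * A 1) * A t"
      unfolding G_def A_def[of t]
    proof (rule weighted_integral_diff)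
      show "\<bar>f s (v s) - f s (w s)\<bar> \<le> d1 / (2 * A 1)" if "s \<in> {0..t}" for s
        using fd[of s "w s" "v s"] v_range[OF v] v_range[OF w] vw that sub by fastforce
    qed (use sub a_nonneg continuous_on_subset[OF _ sub] a_cont f_comp_cont v w in auto)
    also have "\<dots> \<le> d1 / (2 * A 1) * A 1"
      using A_props(2)[of t 1] t d1 A1 by (intro mult_left_mono) auto
    also have "\<dots> < d1" using A1 d1 by simp
    finally show ?thesis unfolding y_def by (intro d1(2) G_range v w t)
  qed
  thus ?thesis using that d by blast
qed

section \<open>The shifted operator and its fixed point\<close>

text \<open>On a nonnegative decreasing function of norm at most \<open>\<rho>\<^sub>2\<close> this adds the constant that raises
  the norm \<open>u 0\<close> to at least \<open>\<rho>\<^sub>1\<close>. The truncation at \<open>\<rho>\<^sub>2\<close> is never active there; it makes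
  \<open>shift\<close> a self-map of \<open>B\<close>.\<close>

definition shift :: "(real \<Rightarrow> real) \<Rightarrow> real \<Rightarrow> real" where
  "shift u t = min \<rho>\<^sub>2 (u t + max 0 (\<rho>\<^sub>1 - u 0))"

lemma shift_B: "u \<in> B \<Longrightarrow> shift u \<in> B"
  using \<rho>\<^sub>2 by (auto simp: B_def shift_def[abs_def] intro!: continuous_intros)

definition T :: "(real \<Rightarrow> real) \<Rightarrow> real \<Rightarrow> real" where
  "T u = green_op \<alpha> \<eta> (y (shift u))"

lemma T_range:
  assumes u: "u \<in> B" and t: "t \<in> {0..1}"
  shows "T u t \<in> {0..\<rho>\<^sub>2}"
proof -
  obtain k where "nonneg_density k (y (shift u))" using density[OF shift_B[OF u]] .
  then interpret nonneg_density k "y (shift u)" .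
  have \<eta>': "\<eta> \<in> {0..1}" using \<eta> by auto
  let ?c = "bvp_const \<alpha> \<eta> (y (shift u))"
  have "0 \<le> ?c" using bvp_const_bounds(1)[OF \<alpha>(1) \<eta>'] J_nonneg[of "\<alpha> + 1" 1] by simp
  moreover have "t powr \<alpha> \<le> 1" using t \<alpha> by (intro powr_le1) auto
  ultimately have "0 \<le> (1 - t powr \<alpha>) * ?c" by simp
  moreover have "T u t \<le> ?c"
    using green_op_decreasing[OF \<alpha>(1), of 0 t] t green_op_0[OF \<alpha>(1)] by (simp add: T_def)
  ultimately show ?thesis
    using green_op_lower[OF \<alpha>(1) \<eta>' t] bvp_const_bounds(2)[OF \<alpha>(1) \<eta>'] integral_Phi_y_less[OF shift_B[OF u]]
    by (simp add: T_def)
qed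

lemma T_Lipschitz:
  assumes u: "u \<in> B" and st: "s \<in> {0..1}" "t \<in> {0..1}"
  shows "\<bar>T u s - T u t\<bar> \<le> \<rho>\<^sub>2 * \<bar>s - t\<bar>"
proof -
  obtain k where "nonneg_density k (y (shift u))" using density[OF shift_B[OF u]] .
  then interpret nonneg_density k "y (shift u)" .
  have "\<bar>T u s - T u t\<bar> \<le> integral {0..1} (\<lambda>s. Phi \<alpha> s * y (shift u) s) * \<bar>s - t\<bar>"
    unfolding T_def by (rule green_op_Lipschitz[OF \<alpha>(1) st])
  also have "\<dots> \<le> \<rho>\<^sub>2 * \<bar>s - t\<bar>"
    using integral_Phi_y_less[OF shift_B[OF u]] by (intro mult_right_mono) auto
  finally show ?thesis .
qed

lemma T_uniformly_continuous:
  assumes "e > 0"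
  shows "\<exists>d>0. \<forall>u\<in>B. \<forall>w\<in>B. (\<forall>t\<in>{0..1}. \<bar>u t - w t\<bar> \<le> d) \<longrightarrow> (\<forall>t\<in>{0..1}. \<bar>T u t - T w t\<bar> < e)"
proof -
  define C where "C = integral {0..1} (Phi \<alpha>) + 1 / Gamma (\<alpha> - 1) + 1 / Gamma \<alpha>"
  have "Gamma (\<alpha> - 1) > 0" "Gamma \<alpha> > 0" using \<alpha> by auto
  hence C: "C > 0" using integral_Phi_pos by (simp add: C_def add_pos_pos)
  hence "e / (2 * C) > 0" using \<open>e > 0\<close> by simp
  then obtain d where d: "d > 0" and y: "\<And>v w t. v \<in> B \<Longrightarrow> w \<in> B \<Longrightarrow> (\<And>s. s \<in> {0..1} \<Longrightarrow> \<bar>v s - w s\<bar> < d) \<Longrightarrow>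
    t \<in> {0..1} \<Longrightarrow> \<bar>y v t - y w t\<bar> < e / (2 * C)" by (rule y_uniformly_continuous) blast
  show ?thesis
  proof (intro exI[of _ "d / 3"] conjI ballI impI)
    fix u w t assume u: "u \<in> B" and w: "w \<in> B" and uw: "\<forall>t\<in>{0..1}. \<bar>u t - w t\<bar> \<le> d / 3" and t: "t \<in> {0..1::real}"
    \<comment> \<open>The change of \<open>shift\<close> is at most the sum of the changes at
      \<open>s\<close> and at 0, hence at most \<open>2 * d / 3\<close>.\<close>
    have shift: "\<bar>shift u s - shift w s\<bar> < d" if "s \<in> {0..1}" for s
    proof -
      have "\<bar>u s - w s\<bar> \<le> d / 3" "\<bar>u 0 - w 0\<bar> \<le> d / 3" using uw that by auto
      thus ?thesis using d unfolding shift_def by linarith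
    qed
    have "\<bar>T u t - T w t\<bar> \<le> e / (2 * C) * C"
      unfolding T_def C_def
    proof (rule green_op_diff)
      show "\<bar>y (shift u) s - y (shift w) s\<bar> \<le> e / (2 * (integral {0..1} (Phi \<alpha>) + 1 / Gamma (\<alpha> - 1) + 1 / Gamma \<alpha>))"
        if "s \<in> {0..1}" for s
        using y[OF shift_B[OF u] shift_B[OF w] shift that] by (simp add: C_def)
    qed (use \<alpha> \<eta> t y_cont shift_B u w in auto)
    also have "\<dots> < e" using C \<open>e > 0\<close> by simp
    finally show "\<bar>T u t - T w t\<bar> < e" .
  qed (use d in auto)
qed

lemma existence: "\<exists>u\<in>bvp_cone \<alpha> \<eta> \<rho>. positive_solution p \<alpha> \<eta> a f u \<and> \<rho>\<^sub>1 < sup_norm u \<and> sup_norm u < \<rho>\<^sub>2"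
proof -
  obtain u where uB: "u \<in> B" and fix_u: "\<And>t. t \<in> {0..1} \<Longrightarrow> T u t = u t"
    using fixed_point_of_lipschitz_range[OF \<rho>\<^sub>2, folded B_def, OF T_range T_Lipschitz T_uniformly_continuous]
    by blast
  define v where "v = shift u"
  have vB: "v \<in> B" unfolding v_def by (rule shift_B[OF uB])
  obtain k where "nonneg_density k (y v)" using density[OF vB] .
  then interpret nonneg_density k "y v" .
  have \<eta>': "\<eta> \<in> {0..1}" using \<eta> by auto
  have u: "u t = green_op \<alpha> \<eta> (y v) t" if "t \<in> {0..1}" for t
    using fix_u[OF that] by (simp add: T_def v_def)
  let ?c = "bvp_const \<alpha> \<eta> (y v)"
  have u0: "u 0 = ?c" using u[of 0] green_op_0[OF \<alpha>(1)] by simp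
  have dec: "u t \<le> u 0" if "t \<in> {0..1}" for t
    using green_op_decreasing[OF \<alpha>(1), of 0 t] u[OF that] u[of 0] that by simp
  have low: "u t \<ge> (1 - t powr \<alpha>) * u 0" if "t \<in> {0..1}" for t
    using green_op_lower[OF \<alpha>(1) \<eta>' that] u[OF that] u0 by simp
  have u0_nonneg: "u 0 \<ge> 0" using v_range[OF uB, of 0] by simp
  have cone: "u t \<ge> \<gamma> * u 0" if "t \<in> {0..\<rho>}" for t
  proof -
    have "t powr \<alpha> \<le> \<rho> powr \<alpha>" using that \<alpha> by (intro powr_mono2) auto
    hence "\<gamma> * u 0 \<le> (1 - t powr \<alpha>) * u 0" using gamma_bounds(3) u0_nonneg by (intro mult_right_mono) auto
    thus ?thesis using low[of t] that \<rho> by auto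
  qed
  have gt: "u 0 > \<rho>\<^sub>1"
  proof (rule ccontr)
    assume "\<not> u 0 > \<rho>\<^sub>1"
    hence le: "u 0 \<le> \<rho>\<^sub>1" by simp
    have "v s \<in> {\<gamma> * \<rho>\<^sub>1..\<rho>\<^sub>1}" if "s \<in> {0..\<rho>}" for s
    proof -
      have "u s \<le> u 0" using dec that \<rho> by auto
      hence v: "v s = u s + (\<rho>\<^sub>1 - u 0)" "v s \<le> \<rho>\<^sub>1" using le \<rho>12 by (auto simp: v_def shift_def)
      \<comment> \<open>As \<open>\<gamma> \<le> 1\<close>, adding a nonnegative constant preserves
        the cone inequality; the norm of the shifted function is
        \<open>\<rho>\<^sub>1\<close>.\<close>
      have "\<gamma> * (\<rho>\<^sub>1 - u 0) \<le> 1 * (\<rho>\<^sub>1 - u 0)" using le gamma_bounds(4) by (intro mult_right_mono) auto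
      hence "\<gamma> * \<rho>\<^sub>1 \<le> v s" using cone[OF that] v by (simp add: algebra_simps)
      thus ?thesis using v by simp
    qed
    from bvp_const_greater[OF vB this] show False using u0 le by simp
  qed
  have less: "u 0 < \<rho>\<^sub>2"
    using u0 bvp_const_bounds(2)[OF \<alpha>(1) \<eta>'] integral_Phi_y_less[OF vB] by simp
  \<comment> \<open>Neither the shift nor the truncation is active, since
    \<open>\<rho>\<^sub>1 < u 0\<close> and \<open>u t \<le> u 0 < \<rho>\<^sub>2\<close>, so
    \<open>u\<close> solves the original equation.\<close>
  have vu: "v t = u t" if "t \<in> {0..1}" for t
    using gt less dec[OF that] by (auto simp: v_def shift_def)
  have norm: "sup_norm u = u 0"
    unfolding sup_norm_def
  proof (rule cSup_eq_maximum)
    show "u 0 \<in> (\<lambda>t. \<bar>u t\<bar>) ` {0..1}" using u0_nonneg by force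
    show "x \<le> u 0" if "x \<in> (\<lambda>t. \<bar>u t\<bar>) ` {0..1}" for x
      using that dec v_range[OF uB] by auto
  qed
  have "(INF t\<in>{0..\<rho>}. u t) \<ge> \<gamma> * sup_norm u"
    unfolding norm using cone \<rho> by (intro cINF_greatest) auto
  hence in_cone: "u \<in> bvp_cone \<alpha> \<eta> \<rho>" using uB v_range[OF uB] by (auto simp: bvp_cone_def B_def)
  have pos: "u t > 0" if "t \<in> {0<..<1}" for t
  proof -
    have "t powr \<alpha> < 1" using that \<alpha> powr_less_mono2[of \<alpha> t 1] by simp
    hence "0 < (1 - t powr \<alpha>) * u 0" using gt \<rho>\<^sub>1 by simp
    thus ?thesis using low[of t] that by auto
  qed
  note sol = green_op_solves[OF \<alpha> \<eta>' u]
  have caputo: "caputo \<alpha> u t = - y v t" if "t \<in> {0..1}" for t by (rule sol(2)[OF _ that])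
  have "continuous_on {0..1} (\<lambda>t. - y v t)" by (intro continuous_intros y_cont[OF vB])
  hence "continuous_on {0..1} (caputo \<alpha> u)"
    by (rule continuous_on_eq) (use caputo in auto)
  moreover have "\<exists>d. ((\<lambda>t. phi p (caputo \<alpha> u t)) has_real_derivative d) (at t) \<and> d + a t * f t (u t) = 0"
    if t: "t \<in> {0<..<1}" for t
  proof (intro exI conjI)
    have der: "((\<lambda>t. - G v t) has_real_derivative - (a t * f t (v t))) (at t)"
      by (intro DERIV_minus G_props(4)[OF vB t])
    \<comment> \<open>\<open>phi p\<close> undoes the power \<open>q - 1\<close>, which leaves the
      differentiable function \<open>- G v\<close>, although \<open>y v\<close> itself need not be
      differentiable.\<close>
    have eq: "- G v s = phi p (caputo \<alpha> u s)" if "s \<in> {0<..<1}" for s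
      using caputo[of s] phi_conjugate(2)[OF p pq G_props(3)[OF vB, of s]] that by (simp add: y_def)
    show "((\<lambda>t. phi p (caputo \<alpha> u t)) has_real_derivative - (a t * f t (v t))) (at t)"
      by (rule has_field_derivative_transform_within_open[OF der _ t]) (use eq in auto)
    show "- (a t * f t (v t)) + a t * f t (u t) = 0" using vu[of t] t by simp
  qed
  moreover have "caputo \<alpha> u 0 = 0" using caputo[of 0] by (simp add: y_def G_def)
  ultimately have "bvp_solution p \<alpha> \<eta> a f u"
    using uB sol by (simp add: bvp_solution_def B_def)
  hence "positive_solution p \<alpha> \<eta> a f u" using pos by (simp add: positive_solution_def)
  thus ?thesis using in_cone norm gt less by auto
qed

end

theorem theorem3p1:
  fixes p q \<alpha> \<eta> \<rho> \<rho>\<^sub>1 \<rho>\<^sub>2 M\<^sub>1 M\<^sub>2 :: real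
    and a :: "real \<Rightarrow> real" and f :: "real \<Rightarrow> real \<Rightarrow> real"
  assumes "p > 1" and "1 / p + 1 / q = 1"
    and "2 < \<alpha>" and "\<alpha> \<le> 3" and "\<eta> \<in> {0<..<1}" and "\<rho> \<in> {0<..<1}"
    and "continuous_on ({0..1} \<times> {0..}) (\<lambda>(t, u). f t u)"
    and "\<And>t u. t \<in> {0..1} \<Longrightarrow> u \<ge> 0 \<Longrightarrow> f t u \<ge> 0"
    and "\<exists>t\<in>{0..1}. f t 0 \<noteq> 0"
    and "continuous_on {0..1} a"
    and "\<And>t. t \<in> {0..1} \<Longrightarrow> a t \<ge> 0"
    and "\<And>c d. 0 \<le> c \<Longrightarrow> c < d \<Longrightarrow> d \<le> 1 \<Longrightarrow> \<exists>t\<in>{c..d}. a t \<noteq> 0"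
    and "\<rho>\<^sub>1 > 0" and "\<rho>\<^sub>2 > 0"
    and "M\<^sub>1 \<in> {0<..Lambda1 q \<alpha> a}" and "M\<^sub>2 \<in> {Lambda2 q \<alpha> \<eta> \<rho> a..}"
    and "\<rho>\<^sub>1 < \<rho>\<^sub>2" and "M\<^sub>2 * \<rho>\<^sub>1 < M\<^sub>1 * \<rho>\<^sub>2"
    and "\<And>t u. u \<in> {0..\<rho>\<^sub>2} \<Longrightarrow> t \<in> {0..1} \<Longrightarrow> f t u \<le> phi p (M\<^sub>1 * \<rho>\<^sub>2)"
    and "\<And>t u. u \<in> {cone_const \<alpha> \<eta> \<rho> * \<rho>\<^sub>1..\<rho>\<^sub>1} \<Longrightarrow> t \<in> {0..\<rho>} \<Longrightarrow> f t u \<ge> phi p (M\<^sub>2 * \<rho>\<^sub>1)"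
  shows "\<exists>u\<in>bvp_cone \<alpha> \<eta> \<rho>. positive_solution p \<alpha> \<eta> a f u \<and> \<rho>\<^sub>1 < sup_norm u \<and> sup_norm u < \<rho>\<^sub>2"
proof -
  interpret p_laplacian_bvp p q \<alpha> \<eta> \<rho> \<rho>\<^sub>1 \<rho>\<^sub>2 M\<^sub>1 M\<^sub>2 a f
    by unfold_locales (use assms in auto)
  show ?thesis by (rule existence)
qed

end
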